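(* For any sequence $\{d(N)\}_{N\geq1}$ of positive integers with $d(N)/N\to c$ for some $0<c<1/2$, there exist $\lambda<1$ and a sequence of simple graphs $\mathbf G=\{G_N\}_{N\geq1}$, $G_N$ having $N$ vertices and minimum degree $d_{\min}(G_N)=d(N)$, such that $\mathbf G$ is not $N$-optimal (for this $\lambda$, the fluid-scaled occupancy process on $G_N$ does not converge to that of the clique).
   Context: Load balancing system on a graph: vertices of $G_N$ are servers with queues of buffer capacity $b$ (possibly infinite); tasks arrive at each server as independent Poisson processes of rate $\lambda$, processing times i.i.d. unit-mean exponential; a task arriving at $v$ is assigned to a shortest queue in $\{v\}\cup\{\text{neighbors of }v\}$, ties uniformly at random. $Q_i(G_N,t)$ is the number of servers with at least $i$ tasks and $q_i(G_N,t)=Q_i(G_N,t)/N$. For cliques $K_N$ (Join-the-Shortest-Queue), for $\lambda<1$, $(q_i(K_N,\cdot))_{i\ge1}$ converges weakly on finite time intervals to a deterministic fluid limit $(q_i(\cdot))_{i\ge1}$. $\mathbf G$ is $N$-optimal if for every $\lambda<1$ and any finite time interval, $(q_i(G_N,\cdot))_{i\ge1}$ converges weakly to this same limit (from the same initial conditions); sub-optimal on $N$-scale means that this fails for some $\lambda<1$.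
   Formalization: The minimum degree of G_N is required to equal d(N) only when d(N) < N; for other N (always N=1, and at most finitely many) no simple graph on N vertices has minimum degree d(N). *)

theory Defs
  imports "HOL-Probability.Probability" "HOL-Library.Extended_Nat"
begin

definition simple_graph :: "nat \<Rightarrow> (nat \<Rightarrow> nat \<Rightarrow> bool) \<Rightarrow> bool" where
  "simple_graph N E \<longleftrightarrow> (\<forall>u v. E u v \<longrightarrow> u < N \<and> v < N \<and> u \<noteq> v \<and> E v u)"

definition degree :: "nat \<Rightarrow> (nat \<Rightarrow> nat \<Rightarrow> bool) \<Rightarrow> nat \<Rightarrow> nat" where
  "degree N E v = card {u. u < N \<and> E v u}"

definition min_degree :: "nat \<Rightarrow> (nat \<Rightarrow> nat \<Rightarrow> bool) \<Rightarrow> nat" where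
  "min_degree N E = Min (degree N E ` {..<N})"

definition clique :: "nat \<Rightarrow> nat \<Rightarrow> nat \<Rightarrow> bool" where
  "clique N u v \<longleftrightarrow> u < N \<and> v < N \<and> u \<noteq> v"

text \<open>A state assigns to each server v < N its queue length (0 for v \<ge> N).\<close>
type_synonym state = "nat \<Rightarrow> nat"

definition closed_nbhd :: "nat \<Rightarrow> (nat \<Rightarrow> nat \<Rightarrow> bool) \<Rightarrow> nat \<Rightarrow> nat set" where
  "closed_nbhd N E v = {u. u < N \<and> (u = v \<or> E v u)}"

definition shortest :: "nat \<Rightarrow> (nat \<Rightarrow> nat \<Rightarrow> bool) \<Rightarrow> state \<Rightarrow> nat \<Rightarrow> nat set" where
  "shortest N E x v = {u \<in> closed_nbhd N E v. \<forall>w \<in> closed_nbhd N E v. x u \<le> x w}"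

text \<open>Uniform choice from a finite set driven by a uniform [0,1] variable.\<close>
definition pick :: "nat set \<Rightarrow> real \<Rightarrow> nat" where
  "pick S r = sorted_list_of_set S ! min (nat \<lfloor>r * real (card S)\<rfloor>) (card S - 1)"

text \<open>One jump of the uniformized chain (total event rate N(1+lam)):
  with probability lam/(1+lam) an arrival at a uniform server v, routed to a uniformly
  chosen shortest queue in the closed neighbourhood of v (lost if that queue is full);
  otherwise a potential departure at a uniform server v (real iff v is busy).
  This gives arrival rate lam at each server and service rate 1 at each busy server.\<close>
definition step :: "nat \<Rightarrow> (nat \<Rightarrow> nat \<Rightarrow> bool) \<Rightarrow> real \<Rightarrow> enat \<Rightarrow> state
                      \<Rightarrow> real \<times> real \<times> real \<Rightarrow> state" where
  "step N E lam b x = (\<lambda>(r1, r2, r3).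
     let v = pick {..<N} r2 in
     if r1 < lam / (1 + lam) then
       (let u = pick (shortest N E x v) r3 in
        if enat (x u) < b then x(u := Suc (x u)) else x)
     else (if 0 < x v then x(v := x v - 1) else x))"

definition unif01 :: "real measure" where
  "unif01 = uniform_measure lborel {0..1}"

definition driving :: "nat \<Rightarrow> real \<Rightarrow> (real \<times> (real \<times> real \<times> real)) measure" where
  "driving N lam = density lborel (exponential_density (real N * (1 + lam)))
                    \<Otimes>\<^sub>M (unif01 \<Otimes>\<^sub>M (unif01 \<Otimes>\<^sub>M unif01))"

definition path_space :: "nat \<Rightarrow> real \<Rightarrow> (real \<times> (real \<times> real \<times> real)) stream measure" where
  "path_space N lam = stream_space (driving N lam)"

fun chain :: "nat \<Rightarrow> (nat \<Rightarrow> nat \<Rightarrow> bool) \<Rightarrow> real \<Rightarrow> enat \<Rightarrow> state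
               \<Rightarrow> (real \<times> (real \<times> real \<times> real)) stream \<Rightarrow> nat \<Rightarrow> state" where
  "chain N E lam b x0 \<omega> 0 = x0"
| "chain N E lam b x0 \<omega> (Suc n) = step N E lam b (chain N E lam b x0 \<omega> n) (snd (\<omega> !! n))"

definition njumps :: "(real \<times> (real \<times> real \<times> real)) stream \<Rightarrow> real \<Rightarrow> nat" where
  "njumps \<omega> t = card {k. 0 < k \<and> (\<Sum>i<k. fst (\<omega> !! i)) \<le> t}"

definition proc :: "nat \<Rightarrow> (nat \<Rightarrow> nat \<Rightarrow> bool) \<Rightarrow> real \<Rightarrow> enat \<Rightarrow> state
               \<Rightarrow> (real \<times> (real \<times> real \<times> real)) stream \<Rightarrow> real \<Rightarrow> state" where
  "proc N E lam b x0 \<omega> t = chain N E lam b x0 \<omega> (njumps \<omega> t)"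

definition occ :: "nat \<Rightarrow> state \<Rightarrow> nat \<Rightarrow> real" where
  "occ N x i = real (card {v. v < N \<and> i \<le> x v}) / real N"

text \<open>Metric inducing the product topology on sequences (q_i)_{i \<ge> 1}.\<close>
definition seq_dist :: "(nat \<Rightarrow> real) \<Rightarrow> (nat \<Rightarrow> real) \<Rightarrow> real" where
  "seq_dist a b = (\<Sum>i. (1/2) ^ i * min 1 \<bar>a (Suc i) - b (Suc i)\<bar>)"

definition outer_prob :: "'a measure \<Rightarrow> 'a set \<Rightarrow> real" where
  "outer_prob M A = Inf (measure M ` {B \<in> sets M. A \<subseteq> B})"

text \<open>Weak convergence on every finite interval [0,T] of the fluid-scaled occupancy
  process to the deterministic (continuous) path q; since the limit is deterministic and
  continuous this is convergence in (outer) probability in the uniform metric.\<close>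
definition fluid_conv :: "(nat \<Rightarrow> nat \<Rightarrow> nat \<Rightarrow> bool) \<Rightarrow> real \<Rightarrow> enat \<Rightarrow> (nat \<Rightarrow> state)
                            \<Rightarrow> (real \<Rightarrow> nat \<Rightarrow> real) \<Rightarrow> bool" where
  "fluid_conv G lam b x0 q \<longleftrightarrow>
     (\<forall>T\<ge>0. \<forall>\<epsilon>>0. (\<lambda>N. outer_prob (path_space N lam)
        {\<omega> \<in> space (path_space N lam).
           (SUP t\<in>{0..T}. seq_dist (occ N (proc N (G N) lam b (x0 N) \<omega> t)) (q t)) > \<epsilon>})
      \<longlonglongrightarrow> 0)"

definition admissible_init :: "nat \<Rightarrow> enat \<Rightarrow> state \<Rightarrow> bool" where
  "admissible_init N b x \<longleftrightarrow> (\<forall>v. enat (x v) \<le> b) \<and> (\<forall>v\<ge>N. x v = 0)"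

definition init_conv :: "(nat \<Rightarrow> state) \<Rightarrow> (nat \<Rightarrow> real) \<Rightarrow> bool" where
  "init_conv x0 q0 \<longleftrightarrow> summable (\<lambda>i. q0 (Suc i)) \<and> (\<forall>i. 0 \<le> q0 (Suc i) \<and> q0 (Suc (Suc i)) \<le> q0 (Suc i)) \<and> q0 1 \<le> 1 \<and>
     (\<lambda>N. \<Sum>i. \<bar>occ N (x0 N) (Suc i) - q0 (Suc i)\<bar>) \<longlonglongrightarrow> 0"

definition N_optimal_at :: "(nat \<Rightarrow> nat \<Rightarrow> nat \<Rightarrow> bool) \<Rightarrow> real \<Rightarrow> enat \<Rightarrow> bool" where
  "N_optimal_at G lam b \<longleftrightarrow>
     (\<forall>x0 y0 q0 q. (\<forall>N. admissible_init N b (x0 N) \<and> admissible_init N b (y0 N))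
        \<and> init_conv x0 q0 \<and> init_conv y0 q0 \<and> fluid_conv clique lam b y0 q
        \<longrightarrow> fluid_conv G lam b x0 q)"

definition N_optimal :: "(nat \<Rightarrow> nat \<Rightarrow> nat \<Rightarrow> bool) \<Rightarrow> enat \<Rightarrow> bool" where
  "N_optimal G b \<longleftrightarrow> (\<forall>lam. 0 < lam \<and> lam < 1 \<longrightarrow> N_optimal_at G lam b)"

end

theory Submission
  imports Defs "HOL-Real_Asymp.Real_Asymp"
begin

text \<open>
  Join \<open>d(N)\<close> core servers to every other server and leave the remaining servers, the leaves,
  pairwise non-adjacent. Start from the fluid equilibrium \<open>q\<^sub>1 = lam\<close>, \<open>q\<^sub>2 = 0\<close> of the clique.
  On the clique the number \<open>Q\<close> of busy servers is attracted by \<open>lam N\<close>, and \<open>(Q - lam N)\<^sup>2\<close> grows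
  by at most 1 per jump on average, so it stays below \<open>(\<epsilon> N)\<^sup>2\<close> for \<open>O(N)\<close> jumps.
  On the core graph a task that arrives at a busy leaf never occupies an idle leaf. If the
  occupancy stayed near the equilibrium, at least \<open>(lam - c) N\<close> leaves would be busy with mostly
  one task, so the number of busy leaves would have drift at most
  \<open>lam - (1 + lam)(lam - c)\<close> up to scaling. This tends to \<open>2 c - 1 < 0\<close> as \<open>lam\<close> tends to 1, hence
  for \<open>lam\<close> close to 1 the number of busy leaves would become negative within \<open>O(N)\<close> jumps.
\<close>

section \<open>Driving measure and measurability of the chain\<close>

lemma prob_space_unif01: "prob_space unif01"
  unfolding unif01_def by (rule prob_space_uniform_measure) auto

lemma sets_unif01 [measurable_cong, simp]: "sets unif01 = sets borel"
  by (simp add: unif01_def)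

lemma space_unif01 [simp]: "space unif01 = UNIV"
  by (simp add: unif01_def)

text \<open>The cutoff at \<open>card S - 1\<close> keeps the index in range for every real
  \<open>r\<close>, so membership holds surely and not only for \<open>r\<close> in the unit
  interval.\<close>

lemma pick_in:
  assumes "finite S" "S \<noteq> {}"
  shows "pick S r \<in> S"
proof -
  have "card S > 0" using assms by (simp add: card_gt_0_iff)
  then have "min (nat \<lfloor>r * real (card S)\<rfloor>) (card S - 1) < length (sorted_list_of_set S)"
    using assms by simp
  then show ?thesis
    unfolding pick_def using assms(1) by (metis nth_mem set_sorted_list_of_set)
qed

lemma measurable_pick [measurable]: "pick S \<in> borel \<rightarrow>\<^sub>M count_space UNIV"
  unfolding pick_def by measurable

lemma pick_lessThan: "pick {..<N} r = min (nat \<lfloor>r * real N\<rfloor>) (N - 1)" if "0 < N"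
proof -
  have "sorted_list_of_set {..<N} = [0..<N]"
    by (simp add: lessThan_atLeast0)
  then show ?thesis
    using that by (simp add: pick_def)
qed

text \<open>Within the unit interval the value \<open>v\<close> is taken on the half-open interval
  from \<open>v / N\<close> to \<open>(v + 1) / N\<close>. The only possible exception is
  \<open>r = 1\<close>, which the cutoff in \<open>pick\<close> sends to the last server; it is a
  null point and is discarded by an almost-everywhere argument.\<close>

lemma emeasure_unif01_pick:
  assumes "v < N"
  shows "emeasure unif01 {r. pick {..<N} r = v} = ennreal (1 / real N)"
proof -
  have N: "0 < N" using assms by simp
  have [measurable]: "{r. pick {..<N} r = v} \<in> sets borel"
    using measurable_sets[OF measurable_pick, of "{v}" "{..<N}"] by (simp add: vimage_def)
  have iff: "r \<in> {0..1} \<inter> {r. pick {..<N} r = v} \<longleftrightarrow> r \<in> {real v / real N..<real (Suc v) / real N}"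
    if "r \<noteq> 1" for r
  proof -
    have A: "real v / real N \<le> r \<and> r < real (Suc v) / real N \<longleftrightarrow> real v \<le> r * real N \<and> r * real N < real v + 1"
      using N by (simp add: field_simps)
    show ?thesis
    proof (cases "0 \<le> r \<and> r < 1")
      case True
      then have "r * real N < real N" using N by simp
      then have lt: "nat \<lfloor>r * real N\<rfloor> < N"
        using True by (simp add: nat_less_iff floor_less_iff)
      then have "pick {..<N} r = nat \<lfloor>r * real N\<rfloor>"
        using N by (simp add: pick_lessThan)
      moreover have "nat \<lfloor>r * real N\<rfloor> = v \<longleftrightarrow> \<lfloor>r * real N\<rfloor> = int v"
        using True by auto
      moreover have "\<lfloor>r * real N\<rfloor> = int v \<longleftrightarrow> real v \<le> r * real N \<and> r * real N < real v + 1"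
        by (simp add: floor_eq_iff)
      ultimately show ?thesis using True A by auto
    next
      case False
      with that have "r < 0 \<or> r > 1" by auto
      moreover have "0 \<le> r" if "real v / real N \<le> r"
        using that by (meson divide_nonneg_nonneg of_nat_0_le_iff order_trans)
      moreover have "r < 1" if "r < real (Suc v) / real N"
      proof -
        have "real (Suc v) / real N \<le> 1" using assms by (simp add: field_simps)
        then show ?thesis using that by linarith
      qed
      ultimately show ?thesis by auto
    qed
  qed
  have "emeasure lborel ({0..1} \<inter> {r. pick {..<N} r = v})
      = emeasure lborel {real v / real N..<real (Suc v) / real N}"
  proof (rule emeasure_eq_AE)
    show "AE r in lborel. (r \<in> {0..1} \<inter> {r. pick {..<N} r = v}) = (r \<in> {real v / real N..<real (Suc v) / real N})"
      using AE_lborel_singleton[of "1::real"] by eventually_elim (use iff in blast)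
  qed auto
  also have "\<dots> = ennreal (1 / real N)"
    using N by (subst emeasure_lborel_Ico) (auto simp: field_simps)
  finally show ?thesis
    by (simp add: unif01_def divide_ennreal_def)
qed

lemma nn_integral_pick:
  fixes h :: "nat \<Rightarrow> ennreal"
  assumes "0 < N"
  shows "(\<integral>\<^sup>+ r. h (pick {..<N} r) \<partial>unif01) = (\<Sum>v<N. h v * ennreal (1 / real N))"
proof -
  have M: "{r. pick {..<N} r = v} \<in> sets unif01" for v
    using measurable_sets[OF measurable_pick, of "{v}" "{..<N}"] by (simp add: vimage_def)
  have "(\<integral>\<^sup>+ r. h (pick {..<N} r) \<partial>unif01)
      = (\<integral>\<^sup>+ r. (\<Sum>v<N. h v * indicator {r. pick {..<N} r = v} r) \<partial>unif01)"
  proof (rule nn_integral_cong)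
    fix r
    have "pick {..<N} r \<in> {..<N}" using assms by (intro pick_in) auto
    then show "h (pick {..<N} r) = (\<Sum>v<N. h v * indicator {r. pick {..<N} r = v} r)"
      by (subst sum.remove[of _ "pick {..<N} r"]) (auto simp: indicator_def)
  qed
  also have "\<dots> = (\<Sum>v<N. h v * ennreal (1 / real N))"
    using M by (subst nn_integral_sum)
      (auto simp: nn_integral_cmult emeasure_unif01_pick intro!: sum.cong)
  finally show ?thesis .
qed

lemma nn_integral_unif01_less:
  assumes "0 \<le> p" "p \<le> 1"
  shows "(\<integral>\<^sup>+ r. (if r < p then A else B) \<partial>unif01) = ennreal p * A + ennreal (1 - p) * B"
proof -
  have e1: "{0..1} \<inter> {..<p} = {0..<p}" and e2: "{0..1} \<inter> {p..} = {p..1}"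
    using assms by auto
  have "(\<integral>\<^sup>+ r. (if r < p then A else B) \<partial>unif01)
      = (\<integral>\<^sup>+ r. A * indicator {..<p} r + B * indicator {p..} r \<partial>unif01)"
    by (rule nn_integral_cong) (auto simp: indicator_def)
  also have "\<dots> = A * emeasure unif01 {..<p} + B * emeasure unif01 {p..}"
    by (subst nn_integral_add) (auto simp: nn_integral_cmult)
  also have "\<dots> = ennreal p * A + ennreal (1 - p) * B"
    using assms by (simp add: unif01_def e1 e2 mult.commute divide_ennreal_def)
  finally show ?thesis .
qed

lemma prob_space_unif01_cubed: "prob_space (unif01 \<Otimes>\<^sub>M (unif01 \<Otimes>\<^sub>M unif01))"
  by (intro prob_space_pair prob_space_unif01)

lemma prob_space_driving:
  assumes "0 < N" "0 < lam"
  shows "prob_space (driving N lam)"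
  unfolding driving_def using assms
  by (intro prob_space_pair prob_space_exponential_density prob_space_unif01_cubed) auto

lemma sets_driving [measurable_cong]:
  "sets (driving N lam) = sets (borel \<Otimes>\<^sub>M (borel \<Otimes>\<^sub>M (borel \<Otimes>\<^sub>M borel)))"
  unfolding driving_def by (intro sets_pair_measure_cong) auto

lemma space_driving [simp]: "space (driving N lam) = UNIV"
  using sets_eq_imp_space_eq[OF sets_driving] by (simp add: space_pair_measure)

lemma space_path_space [simp]: "space (path_space N lam) = UNIV"
  by (simp add: path_space_def space_stream_space)

lemma sets_path_space [measurable_cong]: "sets (path_space N lam) = sets (stream_space (driving N lam))"
  by (simp add: path_space_def)

lemma prob_space_path_space:
  assumes "0 < N" "0 < lam"
  shows "prob_space (path_space N lam)"
  unfolding path_space_def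
  by (intro prob_space.prob_space_stream_space prob_space_driving assms)

lemma nn_integral_driving_fst:
  fixes f :: "real \<Rightarrow> ennreal"
  assumes [measurable]: "f \<in> borel_measurable borel"
  shows "(\<integral>\<^sup>+ s. f (fst s) \<partial>driving N lam)
    = (\<integral>\<^sup>+ x. exponential_density (real N * (1 + lam)) x * f x \<partial>lborel)"
proof -
  interpret U: prob_space "unif01 \<Otimes>\<^sub>M (unif01 \<Otimes>\<^sub>M unif01)" by (rule prob_space_unif01_cubed)
  have "(\<integral>\<^sup>+ s. f (fst s) \<partial>driving N lam)
      = (\<integral>\<^sup>+ x. (\<integral>\<^sup>+ r. f (fst (x, r)) \<partial>(unif01 \<Otimes>\<^sub>M (unif01 \<Otimes>\<^sub>M unif01)))
          \<partial>density lborel (exponential_density (real N * (1 + lam))))"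
    unfolding driving_def by (rule U.nn_integral_fst[symmetric]) measurable
  also have "\<dots> = (\<integral>\<^sup>+ x. f x \<partial>density lborel (exponential_density (real N * (1 + lam))))"
    by (simp only: fst_conv nn_integral_const U.emeasure_space_1 mult_1_right)
  also have "\<dots> = (\<integral>\<^sup>+ x. exponential_density (real N * (1 + lam)) x * f x \<partial>lborel)"
    by (rule nn_integral_density) measurable
  finally show ?thesis .
qed

lemma nn_integral_driving_snd:
  assumes "0 < N" "0 < lam"
    and [measurable]: "f \<in> borel_measurable (borel \<Otimes>\<^sub>M (borel \<Otimes>\<^sub>M borel))"
  shows "(\<integral>\<^sup>+ s. f (snd s) \<partial>driving N lam) = (\<integral>\<^sup>+ r. f r \<partial>(unif01 \<Otimes>\<^sub>M (unif01 \<Otimes>\<^sub>M unif01)))"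
proof -
  interpret U: prob_space "unif01 \<Otimes>\<^sub>M (unif01 \<Otimes>\<^sub>M unif01)" by (rule prob_space_unif01_cubed)
  interpret E: prob_space "density lborel (exponential_density (real N * (1 + lam)))"
    using assms by (intro prob_space_exponential_density) auto
  have [measurable]: "f \<in> borel_measurable (unif01 \<Otimes>\<^sub>M (unif01 \<Otimes>\<^sub>M unif01))" by measurable
  have "(\<integral>\<^sup>+ s. f (snd s) \<partial>driving N lam)
      = (\<integral>\<^sup>+ x. (\<integral>\<^sup>+ r. f (snd (x, r)) \<partial>(unif01 \<Otimes>\<^sub>M (unif01 \<Otimes>\<^sub>M unif01)))
          \<partial>density lborel (exponential_density (real N * (1 + lam))))"
    unfolding driving_def by (rule U.nn_integral_fst[symmetric]) measurable
  also have "\<dots> = (\<integral>\<^sup>+ r. f r \<partial>(unif01 \<Otimes>\<^sub>M (unif01 \<Otimes>\<^sub>M unif01)))"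
    by (simp only: snd_conv nn_integral_const E.emeasure_space_1 mult_1_right)
  finally show ?thesis .
qed

text \<open>The test functions of the drift estimates depend only on the type of the event and on
  the chosen server. The holding time and the tie-breaking variable therefore integrate out, and the
  expectation becomes two finite sums.\<close>

lemma nn_integral_driving_event:
  fixes h :: "bool \<Rightarrow> nat \<Rightarrow> ennreal"
  assumes "0 < N" "0 < lam"
  shows "(\<integral>\<^sup>+ s. h (fst (snd s) < lam / (1 + lam)) (pick {..<N} (fst (snd (snd s)))) \<partial>driving N lam)
    = ennreal (lam / (1 + lam)) * (\<Sum>v<N. h True v * ennreal (1 / real N))
      + ennreal (1 / (1 + lam)) * (\<Sum>v<N. h False v * ennreal (1 / real N))"
proof -
  interpret V: prob_space "unif01 \<Otimes>\<^sub>M unif01" by (intro prob_space_pair prob_space_unif01)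
  interpret U: prob_space unif01 by (rule prob_space_unif01)
  let ?p = "lam / (1 + lam)"
  have p: "0 \<le> ?p" "?p \<le> 1" "1 - ?p = 1 / (1 + lam)"
    using assms by (auto simp: field_simps)
  have "(\<integral>\<^sup>+ s. h (fst (snd s) < ?p) (pick {..<N} (fst (snd (snd s)))) \<partial>driving N lam)
     = (\<integral>\<^sup>+ r. h (fst r < ?p) (pick {..<N} (fst (snd r))) \<partial>(unif01 \<Otimes>\<^sub>M (unif01 \<Otimes>\<^sub>M unif01)))"
    using assms by (intro nn_integral_driving_snd) auto
  also have "\<dots> = (\<integral>\<^sup>+ r1. (\<integral>\<^sup>+ r. h (fst (r1, r) < ?p) (pick {..<N} (fst (snd (r1, r)))) \<partial>(unif01 \<Otimes>\<^sub>M unif01)) \<partial>unif01)"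
    by (rule V.nn_integral_fst[symmetric]) measurable
  also have "\<dots> = (\<integral>\<^sup>+ r1. (\<integral>\<^sup>+ r. h (r1 < ?p) (pick {..<N} (fst r)) \<partial>(unif01 \<Otimes>\<^sub>M unif01)) \<partial>unif01)"
    by (simp only: fst_conv snd_conv)
  also have "\<dots> = (\<integral>\<^sup>+ r1. (\<Sum>v<N. h (r1 < ?p) v * ennreal (1 / real N)) \<partial>unif01)"
  proof (rule nn_integral_cong)
    fix r1
    have "(\<integral>\<^sup>+ r. h (r1 < ?p) (pick {..<N} (fst r)) \<partial>(unif01 \<Otimes>\<^sub>M unif01))
       = (\<integral>\<^sup>+ r2. (\<integral>\<^sup>+ r3. h (r1 < ?p) (pick {..<N} (fst (r2, r3))) \<partial>unif01) \<partial>unif01)"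
      by (rule U.nn_integral_fst[symmetric]) measurable
    also have "\<dots> = (\<integral>\<^sup>+ r2. h (r1 < ?p) (pick {..<N} r2) \<partial>unif01)"
      by (simp only: fst_conv nn_integral_const U.emeasure_space_1 mult_1_right)
    finally show "(\<integral>\<^sup>+ r. h (r1 < ?p) (pick {..<N} (fst r)) \<partial>(unif01 \<Otimes>\<^sub>M unif01))
       = (\<Sum>v<N. h (r1 < ?p) v * ennreal (1 / real N))"
      using assms by (simp add: nn_integral_pick)
  qed
  also have "\<dots> = (\<integral>\<^sup>+ r1. (if r1 < ?p then (\<Sum>v<N. h True v * ennreal (1 / real N))
                     else (\<Sum>v<N. h False v * ennreal (1 / real N))) \<partial>unif01)"
    by (rule nn_integral_cong) auto
  also have "\<dots> = ennreal ?p * (\<Sum>v<N. h True v * ennreal (1 / real N))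
      + ennreal (1 / (1 + lam)) * (\<Sum>v<N. h False v * ennreal (1 / real N))"
    using p by (subst nn_integral_unif01_less) auto
  finally show ?thesis .
qed

text \<open>The set from which the receiving server is picked is itself random, but it depends only
  on the arrival server, which takes countably many values. Measurability for each fixed server is
  therefore enough.\<close>

lemma measurable_step [measurable]:
  "step N E lam b x \<in> borel \<Otimes>\<^sub>M (borel \<Otimes>\<^sub>M borel) \<rightarrow>\<^sub>M count_space UNIV"
proof -
  have [measurable]: "(\<lambda>r. pick (shortest N E x (pick {..<N} (fst (snd r)))) (snd (snd r)))
      \<in> borel \<Otimes>\<^sub>M (borel \<Otimes>\<^sub>M borel) \<rightarrow>\<^sub>M count_space UNIV"
    by (rule measurable_compose_countable[of "\<lambda>v r. pick (shortest N E x v) (snd (snd r))"]) measurable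
  show ?thesis
    unfolding step_def case_prod_beta' Let_def by measurable
qed

text \<open>The type of states is uncountable and carries the discrete sigma-algebra. Composing
  random steps stays measurable because each state has only countably many successors.\<close>

lemma countable_range_step: "countable (range (step N E lam b x))"
proof (rule countable_subset)
  show "range (step N E lam b x)
      \<subseteq> {x} \<union> range (\<lambda>u. x(u := Suc (x u))) \<union> range (\<lambda>u. x(u := x u - 1))"
  proof (rule image_subsetI)
    fix r
    show "step N E lam b x r
      \<in> {x} \<union> range (\<lambda>u. x(u := Suc (x u))) \<union> range (\<lambda>u. x(u := x u - 1))"
      unfolding step_def Let_def case_prod_beta by (simp split: if_split)
  qed
qed auto

text \<open>The recursion of \<open>chain\<close> splits off the last step. This form splits off the
  first one, as conditioning on the first driving variable requires.\<close>

lemma chain_SCons: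
  "chain N E lam b x (s ## \<omega>) (Suc n) = chain N E lam b (step N E lam b x (snd s)) \<omega> n"
  by (induction n) auto

lemma measurable_chain [measurable]:
  "(\<lambda>\<omega>. chain N E lam b x \<omega> n) \<in> stream_space (driving N lam) \<rightarrow>\<^sub>M count_space UNIV"
proof (induction n arbitrary: x)
  case 0
  show ?case by simp
next
  case (Suc n)
  have [measurable]: "(\<lambda>\<omega>. step N E lam b x (snd (shd \<omega>))) \<in> stream_space (driving N lam) \<rightarrow>\<^sub>M count_space UNIV"
    by measurable
  \<comment> \<open>Shrinking the codomain to the countable set of successors makes the composition
    rule for countable index sets applicable.\<close>
  have "(\<lambda>\<omega>. step N E lam b x (snd (shd \<omega>)))
      \<in> stream_space (driving N lam) \<rightarrow>\<^sub>M count_space (range (step N E lam b x))"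
    by (rule measurable_count_space_extend[OF subset_UNIV]) auto
  then have "(\<lambda>\<omega>. chain N E lam b (step N E lam b x (snd (shd \<omega>))) (stl \<omega>) n)
      \<in> stream_space (driving N lam) \<rightarrow>\<^sub>M count_space UNIV"
    by (rule measurable_compose_countable'[rotated])
       (auto intro: countable_range_step measurable_compose[OF measurable_stl Suc.IH])
  moreover have "chain N E lam b (step N E lam b x (snd (shd \<omega>))) (stl \<omega>) n = chain N E lam b x \<omega> (Suc n)" for \<omega>
    using chain_SCons[of N E lam b x "shd \<omega>" "stl \<omega>" n] by simp
  ultimately show ?case by simp
qed

section \<open>First-step analysis and jump times\<close>

lemma UNIV_sets_path_space [simp]: "UNIV \<in> sets (path_space N lam)"
  using sets.top[of "path_space N lam"] by simp

lemma pred_sets_path_space: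
  assumes "Measurable.pred (stream_space (driving N lam)) P"
  shows "{\<omega>. P \<omega>} \<in> sets (path_space N lam)"
  using assms unfolding path_space_def pred_def by (simp add: space_stream_space)

lemma pred_chain [measurable]:
  "Measurable.pred (stream_space (driving N lam)) (\<lambda>\<omega>. chain N E lam b x \<omega> k \<in> A)"
  by (rule measurable_compose[OF measurable_chain]) simp

lemma measurable_of_step [measurable]:
  "(\<lambda>s. f (step N E lam b x (snd s))) \<in> driving N lam \<rightarrow>\<^sub>M borel"
proof -
  have "(\<lambda>s. step N E lam b x (snd s)) \<in> driving N lam \<rightarrow>\<^sub>M count_space UNIV" by measurable
  then show ?thesis by (rule measurable_compose) simp
qed

lemma emeasure_path_first_step:
  assumes "0 < N" "0 < lam" and [measurable]: "Measurable.pred (stream_space (driving N lam)) P"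
  shows "emeasure (path_space N lam) {\<omega>. P \<omega>}
    = (\<integral>\<^sup>+ s. emeasure (path_space N lam) {\<omega>. P (s ## \<omega>)} \<partial>driving N lam)"
proof -
  interpret prob_space "driving N lam" using assms by (intro prob_space_driving)
  have "{\<omega>. P \<omega>} \<in> sets (stream_space (driving N lam))"
    using pred_sets_path_space[of P N lam] by (simp add: path_space_def)
  from emeasure_stream_space[OF this] show ?thesis
    by (simp add: path_space_def space_stream_space)
qed

lemma nn_integral_path_first_step:
  assumes "0 < N" "0 < lam" and "f \<in> borel_measurable (stream_space (driving N lam))"
  shows "(\<integral>\<^sup>+ \<omega>. f \<omega> \<partial>path_space N lam)
    = (\<integral>\<^sup>+ s. (\<integral>\<^sup>+ \<omega>. f (s ## \<omega>) \<partial>path_space N lam) \<partial>driving N lam)"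
proof -
  interpret prob_space "driving N lam" using assms by (intro prob_space_driving)
  show ?thesis
    unfolding path_space_def using assms(3) by (rule nn_integral_stream_space)
qed

lemma all_less_chain_SCons:
  "(\<forall>k<Suc n. chain N E lam b x (s ## \<omega>) k \<in> A)
    \<longleftrightarrow> x \<in> A \<and> (\<forall>k<n. chain N E lam b (step N E lam b x (snd s)) \<omega> k \<in> A)"
  by (simp only: All_less_Suc2 chain_SCons chain.simps(1))

lemma ex_less_chain_SCons:
  "(\<exists>k<Suc n. chain N E lam b x (s ## \<omega>) k \<notin> A)
    \<longleftrightarrow> x \<notin> A \<or> (\<exists>k<n. chain N E lam b (step N E lam b x (snd s)) \<omega> k \<notin> A)"
  using all_less_chain_SCons[of n N E lam b x s \<omega> A] by blast

text \<open>Optional stopping: the survival probabilities in \<open>A\<close> sum to the expected exit time, which the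
  drift bounds by \<open>f x / \<delta>\<close>.\<close>
lemma negative_drift_exit:
  fixes f :: "state \<Rightarrow> ennreal"
  assumes "0 < N" "0 < lam"
    and drift: "\<And>x. x \<in> A \<Longrightarrow> (\<integral>\<^sup>+ s. f (step N E lam b x (snd s)) \<partial>driving N lam) + \<delta> \<le> f x"
  shows "of_nat n * (\<delta> * emeasure (path_space N lam) {\<omega>. \<forall>k<n. chain N E lam b x \<omega> k \<in> A}) \<le> f x"
proof -
  interpret D: prob_space "driving N lam" using assms by (intro prob_space_driving)
  interpret P: prob_space "path_space N lam" using assms by (intro prob_space_path_space)
  define u where "u n x = emeasure (path_space N lam) {\<omega>. \<forall>k<n. chain N E lam b x \<omega> k \<in> A}" for n x
  have u_0: "u 0 x = 1" for x
    using P.emeasure_space_1 by (simp add: u_def)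
  have u_Suc: "u (Suc n) x = (if x \<in> A then (\<integral>\<^sup>+ s. u n (step N E lam b x (snd s)) \<partial>driving N lam) else 0)" for n x
  proof -
    have "u (Suc n) x = (\<integral>\<^sup>+ s. emeasure (path_space N lam)
        {\<omega>. \<forall>k<Suc n. chain N E lam b x (s ## \<omega>) k \<in> A} \<partial>driving N lam)"
      unfolding u_def using assms by (intro emeasure_path_first_step) measurable
    then show ?thesis
      unfolding all_less_chain_SCons by (simp add: u_def)
  qed
  have sum_le: "\<delta> * (\<Sum>j<n. u (Suc j) x) \<le> f x" for x
  proof (induction n arbitrary: x)
    case 0
    show ?case by simp
  next
    case (Suc n)
    show ?case
    proof (cases "x \<in> A")
      case True
      have "\<delta> * (\<Sum>j<Suc n. u (Suc j) x)
          = \<delta> * (\<Sum>j<Suc n. \<integral>\<^sup>+ s. u j (step N E lam b x (snd s)) \<partial>driving N lam)"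
        using True by (simp add: u_Suc)
      also have "\<dots> = (\<integral>\<^sup>+ s. \<delta> * (\<Sum>j<Suc n. u j (step N E lam b x (snd s))) \<partial>driving N lam)"
        by (subst nn_integral_cmult, measurable) (subst nn_integral_sum, measurable)
      \<comment> \<open>The term \<open>u 0 = 1\<close> accounts for the step just made and costs
        one \<delta>, which the drift pays. The other terms are the sum of the induction hypothesis,
        taken at the next state.\<close>
      also have "\<dots> = (\<integral>\<^sup>+ s. \<delta> + \<delta> * (\<Sum>j<n. u (Suc j) (step N E lam b x (snd s))) \<partial>driving N lam)"
        by (rule nn_integral_cong) (simp only: sum.lessThan_Suc_shift u_0 distrib_left mult_1_right)
      also have "\<dots> \<le> (\<integral>\<^sup>+ s. \<delta> + f (step N E lam b x (snd s)) \<partial>driving N lam)"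
        by (intro nn_integral_mono add_left_mono Suc.IH)
      also have "\<dots> = \<delta> + (\<integral>\<^sup>+ s. f (step N E lam b x (snd s)) \<partial>driving N lam)"
        using D.emeasure_space_1 by (subst nn_integral_add) auto
      also have "\<dots> \<le> f x"
        using drift[OF True] by (simp add: add.commute)
      finally show ?thesis .
    qed (simp add: u_Suc)
  qed
  \<comment> \<open>Survival probabilities decrease in time, so the last of the \<open>n\<close>
    summands is the smallest, and \<open>n\<close> copies of it are bounded by the sum.\<close>
  have "u n x \<le> u (Suc j) x" if "j < n" for j
    unfolding u_def using that
    by (intro emeasure_mono pred_sets_path_space) (auto, measurable)
  then have "(\<Sum>j<n. u n x) \<le> (\<Sum>j<n. u (Suc j) x)"
    by (intro sum_mono) simp
  then have "of_nat n * u n x \<le> (\<Sum>j<n. u (Suc j) x)"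
    by simp
  then have "\<delta> * (of_nat n * u n x) \<le> f x"
    using sum_le[of x] by (meson mult_left_mono order_trans zero_le)
  then show ?thesis
    by (simp add: u_def mult.left_commute)
qed

text \<open>Optional stopping: up to the exit from \<open>A\<close>, \<open>f\<close> minus the number of steps is a
  supermartingale.\<close>
lemma bounded_drift_exit:
  fixes f :: "state \<Rightarrow> ennreal"
  assumes "0 < N" "0 < lam"
    and drift: "\<And>x. x \<in> I \<Longrightarrow> x \<in> A \<Longrightarrow> (\<integral>\<^sup>+ s. f (step N E lam b x (snd s)) \<partial>driving N lam) \<le> f x + 1"
    and inv: "\<And>x r. x \<in> I \<Longrightarrow> x \<in> A \<Longrightarrow> step N E lam b x r \<in> I"
    and exit: "\<And>x. x \<in> I \<Longrightarrow> x \<notin> A \<Longrightarrow> K \<le> f x"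
    and "x \<in> I"
  shows "K * emeasure (path_space N lam) {\<omega>. \<exists>k<n. chain N E lam b x \<omega> k \<notin> A} \<le> f x + of_nat n"
  using \<open>x \<in> I\<close>
proof (induction n arbitrary: x)
  case 0
  show ?case by simp
next
  case (Suc n)
  interpret D: prob_space "driving N lam" using assms by (intro prob_space_driving)
  interpret P: prob_space "path_space N lam" using assms by (intro prob_space_path_space)
  let ?w = "\<lambda>y. emeasure (path_space N lam) {\<omega>. \<exists>k<n. chain N E lam b y \<omega> k \<notin> A}"
  show ?case
  proof (cases "x \<in> A")
    case True
    have "emeasure (path_space N lam) {\<omega>. \<exists>k<Suc n. chain N E lam b x \<omega> k \<notin> A}
        = (\<integral>\<^sup>+ s. emeasure (path_space N lam)
            {\<omega>. \<exists>k<Suc n. chain N E lam b x (s ## \<omega>) k \<notin> A} \<partial>driving N lam)"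
      using assms by (intro emeasure_path_first_step) measurable
    also have "\<dots> = (\<integral>\<^sup>+ s. ?w (step N E lam b x (snd s)) \<partial>driving N lam)"
      using True unfolding ex_less_chain_SCons by simp
    finally have "K * emeasure (path_space N lam) {\<omega>. \<exists>k<Suc n. chain N E lam b x \<omega> k \<notin> A}
        = (\<integral>\<^sup>+ s. K * ?w (step N E lam b x (snd s)) \<partial>driving N lam)"
      by (simp add: nn_integral_cmult)
    also have "\<dots> \<le> (\<integral>\<^sup>+ s. f (step N E lam b x (snd s)) + of_nat n \<partial>driving N lam)"
      using Suc.prems True by (intro nn_integral_mono Suc.IH inv)
    also have "\<dots> = (\<integral>\<^sup>+ s. f (step N E lam b x (snd s)) \<partial>driving N lam) + of_nat n"
      using D.emeasure_space_1 by (subst nn_integral_add) auto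
    also have "\<dots> \<le> f x + 1 + of_nat n"
      using Suc.prems True by (intro add_right_mono drift)
    finally show ?thesis by (simp add: ac_simps)
  next
    case False
    \<comment> \<open>The chain is already outside \<open>A\<close>, so \<open>exit\<close> alone
      pays for a probability of at most 1.\<close>
    have "K * emeasure (path_space N lam) {\<omega>. \<exists>k<Suc n. chain N E lam b x \<omega> k \<notin> A} \<le> K * 1"
      by (intro mult_left_mono P.emeasure_le_1) auto
    also have "\<dots> \<le> f x + of_nat (Suc n)"
      using exit[OF Suc.prems False] by (simp add: add_increasing2)
    finally show ?thesis .
  qed
qed

section \<open>Jump times: comparison of the number of jumps with real time\<close>

definition jump_time :: "(real \<times> (real \<times> real \<times> real)) stream \<Rightarrow> nat \<Rightarrow> real" where
  "jump_time \<omega> n = (\<Sum>i<n. fst (\<omega> !! i))"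

lemma measurable_jump_time [measurable]:
  "(\<lambda>\<omega>. jump_time \<omega> n) \<in> stream_space (driving N lam) \<rightarrow>\<^sub>M borel"
  unfolding jump_time_def by measurable

lemma jump_time_SCons: "jump_time (s ## \<omega>) (Suc n) = fst s + jump_time \<omega> n"
  by (simp add: jump_time_def sum.lessThan_Suc_shift del: sum.lessThan_Suc)

text \<open>The exponential density vanishes on the negative axis and the point 0 is null.
  Positivity makes the jump times strictly increasing, which is what reading off
  \<open>njumps\<close> requires.\<close>

lemma AE_holding_times_pos:
  assumes "0 < N" "0 < lam"
  shows "AE \<omega> in path_space N lam. \<forall>i. 0 < fst (\<omega> !! i)"
proof -
  interpret D: prob_space "driving N lam" using assms by (intro prob_space_driving)
  have "{s \<in> space (driving N lam). \<not> 0 < fst s} \<in> sets (driving N lam)" by measurable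
  then have meas: "{s. \<not> 0 < fst s} \<in> sets (driving N lam)" by simp
  have "emeasure (driving N lam) {s. \<not> 0 < fst s}
      = (\<integral>\<^sup>+ s. indicator {s. \<not> 0 < fst s} s \<partial>driving N lam)"
    by (simp add: nn_integral_indicator[OF meas])
  also have "\<dots> = (\<integral>\<^sup>+ s. indicator {..0} (fst s) \<partial>driving N lam)"
    by (rule nn_integral_cong) (auto simp: indicator_def)
  also have "\<dots> = (\<integral>\<^sup>+ x. ennreal (exponential_density (real N * (1 + lam)) x) * indicator {..0::real} x \<partial>lborel)"
    by (rule nn_integral_driving_fst) measurable
  also have "\<dots> = 0"
  proof (rule nn_integral_zero')
    show "AE x in lborel. ennreal (exponential_density (real N * (1 + lam)) x) * indicator {..0::real} x = 0"
      using AE_lborel_singleton[of "0::real"]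
      by eventually_elim (auto simp: exponential_density_def indicator_def)
  qed
  finally have "AE s in driving N lam. 0 < fst s"
    using meas by (subst AE_iff_measurable[OF _ refl]) auto
  then have "AE \<omega> in stream_space (driving N lam). stream_all (\<lambda>s. 0 < fst s) \<omega>"
    by (intro D.AE_stream_all) measurable
  then show ?thesis
    unfolding path_space_def by (simp add: sset_range)
qed

text \<open>The base case is the mean of an exponential variable of rate
  \<open>N * (1 + lam)\<close>, obtained as a first Erlang moment. The induction drops the head of
  the stream, which leaves the law of the tail unchanged.\<close>

lemma nn_integral_holding_time:
  assumes "0 < N" "0 < lam"
  shows "(\<integral>\<^sup>+ \<omega>. ennreal (fst (\<omega> !! i)) \<partial>path_space N lam) = ennreal (1 / (real N * (1 + lam)))"
proof (induction i)
  case 0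
  interpret P: prob_space "path_space N lam" using assms by (intro prob_space_path_space)
  let ?l = "real N * (1 + lam)"
  have l: "0 < ?l" using assms by simp
  have "(\<integral>\<^sup>+ \<omega>. ennreal (fst (\<omega> !! 0)) \<partial>path_space N lam)
      = (\<integral>\<^sup>+ s. (\<integral>\<^sup>+ \<omega>. ennreal (fst ((s ## \<omega>) !! 0)) \<partial>path_space N lam) \<partial>driving N lam)"
    using assms by (intro nn_integral_path_first_step) measurable
  also have "\<dots> = (\<integral>\<^sup>+ s. ennreal (fst s) \<partial>driving N lam)"
    using P.emeasure_space_1 by simp
  also have "\<dots> = (\<integral>\<^sup>+ x. exponential_density ?l x * ennreal x \<partial>lborel)"
    by (rule nn_integral_driving_fst) measurable
  also have "\<dots> = (\<integral>\<^sup>+ x. ennreal (exponential_density ?l x * x ^ 1) \<partial>lborel)"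
    using l by (intro nn_integral_cong) (simp add: ennreal_mult' exponential_density_nonneg)
  also have "\<dots> = ennreal (1 / ?l)"
    using nn_integral_erlang_ith_moment[OF l, of 0 1] by simp
  finally show ?case .
next
  case (Suc i)
  interpret D: prob_space "driving N lam" using assms by (intro prob_space_driving)
  have "(\<integral>\<^sup>+ \<omega>. ennreal (fst (\<omega> !! Suc i)) \<partial>path_space N lam)
      = (\<integral>\<^sup>+ s. (\<integral>\<^sup>+ \<omega>. ennreal (fst ((s ## \<omega>) !! Suc i)) \<partial>path_space N lam) \<partial>driving N lam)"
    using assms by (intro nn_integral_path_first_step) measurable
  then show ?case
    using D.emeasure_space_1 Suc.IH by simp
qed

text \<open>Markov's inequality for the sum of the \<open>n\<close> mean holding times. Coercion to
  \<open>ennreal\<close> replaces negative holding times by 0, which can only enlarge the sum, so no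
  almost-sure positivity enters.\<close>

lemma emeasure_jump_time_gt:
  assumes "0 < N" "0 < lam" "0 < T"
  shows "emeasure (path_space N lam) {\<omega>. T < jump_time \<omega> n}
    \<le> ennreal (real n / (real N * (1 + lam) * T))"
proof -
  let ?P = "path_space N lam"
  let ?u = "\<lambda>\<omega>. \<Sum>i<n. ennreal (fst (\<omega> !! i))"
  have [measurable]: "?u \<in> borel_measurable ?P" by measurable
  have "emeasure ?P {\<omega>. T < jump_time \<omega> n}
      \<le> emeasure ?P {\<omega> \<in> space ?P. 1 \<le> ennreal (1 / T) * ?u \<omega>}"
  proof (rule emeasure_mono)
    show "{\<omega>. T < jump_time \<omega> n} \<subseteq> {\<omega> \<in> space ?P. 1 \<le> ennreal (1 / T) * ?u \<omega>}"
    proof safe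
      fix \<omega> assume "T < jump_time \<omega> n"
      also have "jump_time \<omega> n \<le> (\<Sum>i<n. max 0 (fst (\<omega> !! i)))"
        unfolding jump_time_def by (intro sum_mono) simp
      finally have "1 \<le> 1 / T * (\<Sum>i<n. max 0 (fst (\<omega> !! i)))"
        using assms by (simp add: field_simps)
      then have "ennreal 1 \<le> ennreal (1 / T * (\<Sum>i<n. max 0 (fst (\<omega> !! i))))"
        by (rule ennreal_leI)
      also have "\<dots> = ennreal (1 / T) * ennreal (\<Sum>i<n. max 0 (fst (\<omega> !! i)))"
        using assms by (intro ennreal_mult') simp
      also have "ennreal (\<Sum>i<n. max 0 (fst (\<omega> !! i))) = (\<Sum>i<n. ennreal (max 0 (fst (\<omega> !! i))))"
        by (rule sum_ennreal[symmetric]) simp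
      also have "(\<Sum>i<n. ennreal (max 0 (fst (\<omega> !! i)))) = ?u \<omega>"
        by (intro sum.cong) (auto simp: max_def ennreal_neg)
      finally show "1 \<le> ennreal (1 / T) * ?u \<omega>" by simp
    qed simp
  qed measurable
  also have "\<dots> \<le> ennreal (1 / T) * (\<integral>\<^sup>+ \<omega>. ?u \<omega> * indicator (space ?P) \<omega> \<partial>?P)"
    using nn_integral_Markov_inequality[of ?u "space ?P" ?P "ennreal (1 / T)"] by simp
  also have "(\<integral>\<^sup>+ \<omega>. ?u \<omega> * indicator (space ?P) \<omega> \<partial>?P) = (\<integral>\<^sup>+ \<omega>. ?u \<omega> \<partial>?P)"
    by simp
  also have "\<dots> = of_nat n * ennreal (1 / (real N * (1 + lam)))"
    by (subst nn_integral_sum) (auto simp: nn_integral_holding_time assms)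
  also have "ennreal (1 / T) * \<dots> = ennreal (real n / (real N * (1 + lam) * T))"
    using assms by (simp add: ennreal_of_nat_eq_real_of_nat ennreal_mult'[symmetric] field_simps)
  finally show ?thesis .
qed

text \<open>Laplace transform of a sum of \<open>n\<close> independent exponential variables of rate
  \<open>l = N * (1 + lam)\<close>, evaluated at \<open>l\<close> itself: each contributes the
  factor \<open>l / (l + l) = 1 / 2\<close>.\<close>

lemma nn_integral_exp_jump_time:
  assumes "0 < N" "0 < lam"
  shows "(\<integral>\<^sup>+ \<omega>. ennreal (exp (- (real N * (1 + lam) * jump_time \<omega> n))) \<partial>path_space N lam)
    = ennreal ((1 / 2) ^ n)"
proof (induction n)
  case 0
  interpret P: prob_space "path_space N lam" using assms by (intro prob_space_path_space)
  show ?case using P.emeasure_space_1 by (simp add: jump_time_def)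
next
  case (Suc n)
  let ?l = "real N * (1 + lam)"
  have l: "0 < ?l" "0 < 2 * ?l" using assms by auto
  interpret E: prob_space "density lborel (exponential_density (2 * ?l))"
    using l(2) by (rule prob_space_exponential_density)
  have "(\<integral>\<^sup>+ \<omega>. ennreal (exp (- (?l * jump_time \<omega> (Suc n)))) \<partial>path_space N lam)
      = (\<integral>\<^sup>+ s. (\<integral>\<^sup>+ \<omega>. ennreal (exp (- (?l * jump_time (s ## \<omega>) (Suc n)))) \<partial>path_space N lam) \<partial>driving N lam)"
    using assms by (intro nn_integral_path_first_step) measurable
  also have "\<dots> = (\<integral>\<^sup>+ s. (\<integral>\<^sup>+ \<omega>. ennreal (exp (- (?l * fst s))) * ennreal (exp (- (?l * jump_time \<omega> n))) \<partial>path_space N lam) \<partial>driving N lam)"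
    by (intro nn_integral_cong)
       (simp add: jump_time_SCons ennreal_mult[symmetric] exp_add[symmetric] distrib_left)
  also have "\<dots> = (\<integral>\<^sup>+ s. ennreal (exp (- (?l * fst s))) * ennreal ((1 / 2) ^ n) \<partial>driving N lam)"
    by (subst nn_integral_cmult) (measurable, simp add: Suc.IH)
  also have "\<dots> = (\<integral>\<^sup>+ s. ennreal (exp (- (?l * fst s))) \<partial>driving N lam) * ennreal ((1 / 2) ^ n)"
    by (subst nn_integral_multc) measurable
  also have "(\<integral>\<^sup>+ s. ennreal (exp (- (?l * fst s))) \<partial>driving N lam)
      = (\<integral>\<^sup>+ x. exponential_density ?l x * ennreal (exp (- (?l * x))) \<partial>lborel)"
    by (rule nn_integral_driving_fst) measurable
  \<comment> \<open>The tilted density of rate \<open>l\<close> is half the density of rate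
    \<open>2 * l\<close>, and the latter has total mass 1.\<close>
  also have "\<dots> = (\<integral>\<^sup>+ x. ennreal (1 / 2) * exponential_density (2 * ?l) x \<partial>lborel)"
  proof (rule nn_integral_cong)
    fix x
    have "exponential_density ?l x * exp (- (?l * x)) = 1 / 2 * exponential_density (2 * ?l) x"
      by (simp add: exponential_density_def mult_exp_exp algebra_simps)
    then show "ennreal (exponential_density ?l x) * ennreal (exp (- (?l * x)))
        = ennreal (1 / 2) * ennreal (exponential_density (2 * ?l) x)"
      by (simp only: ennreal_mult''[OF exp_ge_zero, symmetric]
          ennreal_mult'[OF zero_le_divide_1_iff[THEN iffD2, OF zero_le_numeral]])
  qed
  also have "\<dots> = ennreal (1 / 2) * emeasure (density lborel (exponential_density (2 * ?l))) UNIV"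
    by (subst nn_integral_cmult) (auto simp: emeasure_density)
  also have "emeasure (density lborel (exponential_density (2 * ?l))) UNIV = 1"
    using E.emeasure_space_1 by simp
  finally show ?case
    by (simp only: mult_1_right power_Suc ennreal_mult' zero_le_divide_1_iff zero_le_numeral)
qed

text \<open>Chernoff's bound with the exponent used in the Laplace transform above. With
  \<open>n\<close> a large multiple of \<open>N\<close>, the power of 1/2 beats the exponential
  factor.\<close>

lemma emeasure_jump_time_le:
  assumes "0 < N" "0 < lam"
  shows "emeasure (path_space N lam) {\<omega>. jump_time \<omega> n \<le> T}
    \<le> ennreal (exp (real N * (1 + lam) * T) * (1 / 2) ^ n)"
proof -
  let ?P = "path_space N lam" and ?l = "real N * (1 + lam)"
  let ?u = "\<lambda>\<omega>. ennreal (exp (- (?l * jump_time \<omega> n)))"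
  have [measurable]: "?u \<in> borel_measurable ?P" by measurable
  have l: "0 < ?l" using assms by simp
  have "emeasure ?P {\<omega>. jump_time \<omega> n \<le> T}
      \<le> emeasure ?P {\<omega> \<in> space ?P. 1 \<le> ennreal (exp (?l * T)) * ?u \<omega>}"
  proof (rule emeasure_mono)
    show "{\<omega>. jump_time \<omega> n \<le> T} \<subseteq> {\<omega> \<in> space ?P. 1 \<le> ennreal (exp (?l * T)) * ?u \<omega>}"
    proof safe
      fix \<omega> assume "jump_time \<omega> n \<le> T"
      then have "?l * jump_time \<omega> n \<le> ?l * T" using l by (intro mult_left_mono) auto
      then have "ennreal 1 \<le> ennreal (exp (?l * T + - (?l * jump_time \<omega> n)))"
        by (intro ennreal_leI) simp
      also have "\<dots> = ennreal (exp (?l * T)) * ?u \<omega>"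
        by (subst exp_add) (rule ennreal_mult, auto)
      finally show "1 \<le> ennreal (exp (?l * T)) * ?u \<omega>" by simp
    qed simp
  qed measurable
  also have "\<dots> \<le> ennreal (exp (?l * T)) * (\<integral>\<^sup>+ \<omega>. ?u \<omega> * indicator (space ?P) \<omega> \<partial>?P)"
    using nn_integral_Markov_inequality[of ?u "space ?P" ?P "ennreal (exp (?l * T))"] by simp
  also have "(\<integral>\<^sup>+ \<omega>. ?u \<omega> * indicator (space ?P) \<omega> \<partial>?P) = (\<integral>\<^sup>+ \<omega>. ?u \<omega> \<partial>?P)"
    by simp
  also have "\<dots> = ennreal ((1 / 2) ^ n)"
    using assms by (rule nn_integral_exp_jump_time)
  finally show ?thesis
    by (simp add: ennreal_mult)
qed

lemma strict_mono_jump_time: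
  assumes "\<forall>i. 0 < fst (\<omega> !! i)"
  shows "strict_mono (jump_time \<omega>)"
  unfolding strict_mono_Suc_iff using assms by (simp add: jump_time_def)

text \<open>The counted indices are exactly 1 to \<open>n\<close>, index 0 being excluded by
  definition. Hence the process at the \<open>n\<close>-th jump time is in the \<open>n\<close>-th
  state of the chain, and every state of the chain is seen by the process.\<close>

lemma njumps_jump_time:
  assumes "\<forall>i. 0 < fst (\<omega> !! i)"
  shows "njumps \<omega> (jump_time \<omega> n) = n"
proof -
  have "{k. 0 < k \<and> jump_time \<omega> k \<le> jump_time \<omega> n} = {1..n}"
    using strict_mono_less_eq[OF strict_mono_jump_time[OF assms]] by auto
  then show ?thesis
    unfolding njumps_def jump_time_def by simp
qed

text \<open>By strict monotonicity all counted indices lie between 1 and \<open>n\<close>. Up to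
  such a time the process only visits the first \<open>Suc n\<close> states of the chain, the
  initial one included.\<close>

lemma njumps_less:
  assumes "\<forall>i. 0 < fst (\<omega> !! i)" "t < jump_time \<omega> (Suc n)"
  shows "njumps \<omega> t < Suc n"
proof -
  have "{k. 0 < k \<and> jump_time \<omega> k \<le> t} \<subseteq> {1..n}"
  proof safe
    fix k assume "0 < k" "jump_time \<omega> k \<le> t"
    then have "jump_time \<omega> k < jump_time \<omega> (Suc n)" using assms(2) by simp
    then have "k < Suc n" using strict_mono_less[OF strict_mono_jump_time[OF assms(1)]] by blast
    then show "k \<in> {1..n}" using \<open>0 < k\<close> by auto
  qed
  then have "card {k. 0 < k \<and> jump_time \<omega> k \<le> t} \<le> card {1..n}"
    by (intro card_mono) auto
  then show ?thesis
    unfolding njumps_def jump_time_def by simp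
qed

section \<open>One-step drifts\<close>

text \<open>The set is a parameter because the clique needs all servers \<open>{..<N}\<close>, the
  core graph only the leaves \<open>{d..<N}\<close>.\<close>

definition busy :: "nat set \<Rightarrow> state \<Rightarrow> nat" where
  "busy S x = card {v \<in> S. 0 < x v}"

lemma occ_1: "occ N x 1 = real (busy {..<N} x) / real N"
  by (simp add: occ_def busy_def Suc_le_eq)

lemma busy_le_card: "finite S \<Longrightarrow> busy S x \<le> card S"
  unfolding busy_def by (rule card_mono) auto

lemma busy_arrival:
  assumes "finite S"
  shows "busy S (x(u := Suc (x u))) = busy S x + (if u \<in> S \<and> x u = 0 then 1 else 0)"
proof (cases "u \<in> S \<and> x u = 0")
  case True
  then have "{v \<in> S. 0 < (x(u := Suc (x u))) v} = insert u {v \<in> S. 0 < x v}"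
    by auto
  then show ?thesis using True assms by (simp add: busy_def)
next
  case False
  then have "{v \<in> S. 0 < (x(u := Suc (x u))) v} = {v \<in> S. 0 < x v}"
    by auto
  then show ?thesis using False by (simp add: busy_def)
qed

lemma busy_departure:
  assumes "finite S"
  shows "busy S (x(u := x u - 1)) + (if u \<in> S \<and> x u = 1 then 1 else 0) = busy S x"
proof (cases "u \<in> S \<and> x u = 1")
  case True
  then have "{v \<in> S. 0 < x v} = insert u {v \<in> S. 0 < (x(u := x u - 1)) v}"
    by auto
  then show ?thesis using True assms by (simp add: busy_def)
next
  case False
  then have "{v \<in> S. 0 < (x(u := x u - 1)) v} = {v \<in> S. 0 < x v}"
    by auto
  then show ?thesis using False by (simp add: busy_def)
qed

lemma pick_shortest:
  assumes "v < N"
  shows "pick (shortest N E x v) r \<in> shortest N E x v"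
proof (rule pick_in)
  have fin: "finite (closed_nbhd N E v)" and ne: "closed_nbhd N E v \<noteq> {}"
    using assms by (auto simp: closed_nbhd_def)
  then show "finite (shortest N E x v)"
    by (simp add: shortest_def)
  obtain u where "u \<in> closed_nbhd N E v" "\<forall>w \<in> closed_nbhd N E v. x u \<le> x w"
    using arg_min_if_finite[OF fin ne, of x] by (meson not_less)
  then show "shortest N E x v \<noteq> {}"
    by (auto simp: shortest_def)
qed

lemma pick_server: "0 < N \<Longrightarrow> pick {..<N} r < N"
  using pick_in[of "{..<N}" r] by auto

lemma nn_integral_driving_event_real:
  fixes g :: "bool \<Rightarrow> nat \<Rightarrow> real"
  assumes "0 < N" "0 < lam" and g: "\<And>a v. v < N \<Longrightarrow> 0 \<le> g a v"
  shows "(\<integral>\<^sup>+ s. ennreal (g (fst (snd s) < lam / (1 + lam)) (pick {..<N} (fst (snd (snd s))))) \<partial>driving N lam)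
    = ennreal ((lam * (\<Sum>v<N. g True v) + (\<Sum>v<N. g False v)) / (real N * (1 + lam)))"
proof -
  have S: "(\<Sum>v<N. ennreal (g a v) * ennreal (1 / real N)) = ennreal ((\<Sum>v<N. g a v) / real N)" for a
  proof -
    have "(\<Sum>v<N. ennreal (g a v) * ennreal (1 / real N)) = (\<Sum>v<N. ennreal (g a v / real N))"
      by (intro sum.cong) (auto simp: ennreal_mult[symmetric] g)
    also have "\<dots> = ennreal (\<Sum>v<N. g a v / real N)"
      by (rule sum_ennreal) (auto intro!: divide_nonneg_nonneg g)
    finally show ?thesis by (simp add: sum_divide_distrib)
  qed
  have nonneg: "0 \<le> (\<Sum>v<N. g a v)" for a
    by (intro sum_nonneg) (auto intro: g)
  have "(\<integral>\<^sup>+ s. ennreal (g (fst (snd s) < lam / (1 + lam)) (pick {..<N} (fst (snd (snd s))))) \<partial>driving N lam)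
    = ennreal (lam / (1 + lam)) * ennreal ((\<Sum>v<N. g True v) / real N)
      + ennreal (1 / (1 + lam)) * ennreal ((\<Sum>v<N. g False v) / real N)"
    using nn_integral_driving_event[OF assms(1,2), of "\<lambda>a v. ennreal (g a v)"] unfolding S .
  also have "\<dots> = ennreal (lam / (1 + lam) * ((\<Sum>v<N. g True v) / real N)
      + 1 / (1 + lam) * ((\<Sum>v<N. g False v) / real N))"
  proof -
    have e: "ennreal (lam / (1 + lam)) * ennreal ((\<Sum>v<N. g True v) / real N)
        = ennreal (lam / (1 + lam) * ((\<Sum>v<N. g True v) / real N))"
      "ennreal (1 / (1 + lam)) * ennreal ((\<Sum>v<N. g False v) / real N)
        = ennreal (1 / (1 + lam) * ((\<Sum>v<N. g False v) / real N))"
      by (rule ennreal_mult'[symmetric], use assms in simp)+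
    show ?thesis
      unfolding e by (rule ennreal_plus[symmetric]) (use assms nonneg in simp_all)
  qed
  also have "lam / (1 + lam) * ((\<Sum>v<N. g True v) / real N) + 1 / (1 + lam) * ((\<Sum>v<N. g False v) / real N)
      = (lam * (\<Sum>v<N. g True v) + (\<Sum>v<N. g False v)) / (real N * (1 + lam))"
    by (simp add: add_divide_distrib mult.commute)
  finally show ?thesis .
qed

lemma sum_if_card:
  assumes "finite S"
  shows "(\<Sum>v\<in>S. if P v then a else c) = real (card {v \<in> S. P v}) * a + (real (card S) - real (card {v \<in> S. P v})) * (c :: real)"
proof -
  have "card {v \<in> S. \<not> P v} = card S - card {v \<in> S. P v}"
  proof -
    have "{v \<in> S. \<not> P v} = S - {v \<in> S. P v}" by auto
    then show ?thesis using assms by (simp add: card_Diff_subset)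
  qed
  moreover have "card {v \<in> S. P v} \<le> card S"
    using assms by (intro card_mono) auto
  moreover have "S \<inter> Collect P = {v \<in> S. P v}" "S \<inter> - Collect P = {v \<in> S. \<not> P v}"
    by auto
  ultimately show ?thesis
    using assms by (simp add: sum.If_cases)
qed

text \<open>Some server is idle, and on the clique every arrival sees it. A task thus always joins
  an idle server, where \<open>1 \<le> b\<close> guarantees room; queues never exceed 1, and each
  departure from a busy server makes it idle.\<close>

lemma clique_step:
  fixes x :: state and lam r1 r2 r3 :: real
  assumes "0 < N" "1 \<le> b" "\<And>v. x v \<le> 1" "busy {..<N} x < N"
  defines "y \<equiv> step N (clique N) lam b x (r1, r2, r3)"
  shows "y v \<le> 1"
    and "real (busy {..<N} y) = real (busy {..<N} x) +
      (if r1 < lam / (1 + lam) then 1 else if 0 < x (pick {..<N} r2) then -1 else 0)"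
proof -
  let ?v = "pick {..<N} r2" and ?u = "pick (shortest N (clique N) x (pick {..<N} r2)) r3"
  have v: "?v < N" using assms(1) by (rule pick_server)
  have u: "?u \<in> shortest N (clique N) x ?v" using v by (rule pick_shortest)
  have "closed_nbhd N (clique N) ?v = {..<N}"
    using v by (auto simp: closed_nbhd_def clique_def)
  then have u': "?u < N" "\<And>w. w < N \<Longrightarrow> x ?u \<le> x w"
    using u by (auto simp: shortest_def)
  have "\<exists>w<N. x w = 0"
  proof (rule ccontr)
    assume "\<not> (\<exists>w<N. x w = 0)"
    then have "{v \<in> {..<N}. 0 < x v} = {..<N}" by auto
    then show False using assms(4) by (simp add: busy_def)
  qed
  then have xu: "x ?u = 0" using u'(2) by fastforce
  have "enat 0 < b" using assms(2) by (metis one_enat_def enat_ord_simps(2) less_le_trans zero_less_one)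
  then have y: "y = (if r1 < lam / (1 + lam) then x(?u := Suc (x ?u)) else
      if 0 < x ?v then x(?v := x ?v - 1) else x)"
    unfolding y_def step_def by (simp add: Let_def xu)
  show "y v \<le> 1"
    using assms(3)[of v] assms(3)[of ?v] by (simp add: y xu)
  have "x ?v = 1" if "0 < x ?v" using assms(3)[of ?v] that by simp
  moreover have "busy {..<N} (x(?u := Suc 0)) = Suc (busy {..<N} x)"
    using busy_arrival[of "{..<N}" x ?u] u'(1) xu by simp
  ultimately show "real (busy {..<N} y) = real (busy {..<N} x) +
      (if r1 < lam / (1 + lam) then 1 else if 0 < x ?v then -1 else 0)"
    using busy_departure[of "{..<N}" x ?v] v u'(1)
    by (auto simp: y xu simp del: fun_upd_apply)
qed

text \<open>With \<open>D\<close> the deviation of the number \<open>B\<close> of busy servers, the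
  rates are \<open>lam * N\<close> for \<open>D + 1\<close> and \<open>B\<close> for
  \<open>D - 1\<close>. The linear terms combine to \<open>- 2 * D\<^sup>2\<close>, which is not
  positive; the constant terms \<open>lam * N + B\<close> stay below the total rate
  \<open>N * (1 + lam)\<close>.\<close>

lemma clique_variance_drift:
  assumes "0 < N" "0 < lam" "1 \<le> b" "\<And>v. x v \<le> 1" "busy {..<N} x < N"
  shows "(\<integral>\<^sup>+ s. ennreal ((real (busy {..<N} (step N (clique N) lam b x (snd s))) - lam * real N)\<^sup>2) \<partial>driving N lam)
    \<le> ennreal ((real (busy {..<N} x) - lam * real N)\<^sup>2) + 1"
proof -
  define B where "B = real (busy {..<N} x)"
  define D where "D = B - lam * real N"
  define g where "g a v = (if a then (D + 1)\<^sup>2 else if 0 < x v then (D - 1)\<^sup>2 else D\<^sup>2)" for a v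
  have B: "B < real N" using assms(5) by (simp add: B_def)
  have "(\<integral>\<^sup>+ s. ennreal ((real (busy {..<N} (step N (clique N) lam b x (snd s))) - lam * real N)\<^sup>2) \<partial>driving N lam)
      = (\<integral>\<^sup>+ s. ennreal (g (fst (snd s) < lam / (1 + lam)) (pick {..<N} (fst (snd (snd s))))) \<partial>driving N lam)"
  proof (rule nn_integral_cong)
    fix s :: "real \<times> real \<times> real \<times> real"
    obtain w r1 r2 r3 where s: "s = (w, r1, r2, r3)" by (cases s) auto
    have "real (busy {..<N} (step N (clique N) lam b x (snd s))) - lam * real N
        = D + (if r1 < lam / (1 + lam) then 1 else if 0 < x (pick {..<N} r2) then -1 else 0)"
      using clique_step(2)[OF assms(1,3-5)] by (simp add: s D_def B_def)
    then show "ennreal ((real (busy {..<N} (step N (clique N) lam b x (snd s))) - lam * real N)\<^sup>2)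
        = ennreal (g (fst (snd s) < lam / (1 + lam)) (pick {..<N} (fst (snd (snd s)))))"
      by (simp add: s g_def)
  qed
  also have "\<dots> = ennreal ((lam * (\<Sum>v<N. g True v) + (\<Sum>v<N. g False v)) / (real N * (1 + lam)))"
    using assms by (intro nn_integral_driving_event_real) (auto simp: g_def)
  also have "\<dots> \<le> ennreal (D\<^sup>2 + 1)"
  proof (rule ennreal_leI)
    have "(\<Sum>v<N. g False v) = B * (D - 1)\<^sup>2 + (real N - B) * D\<^sup>2"
      by (simp add: g_def B_def busy_def sum_if_card)
    then have "lam * (\<Sum>v<N. g True v) + (\<Sum>v<N. g False v)
        = lam * real N * (D + 1)\<^sup>2 + B * (D - 1)\<^sup>2 + (real N - B) * D\<^sup>2"
      by (simp add: g_def)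
    also have "\<dots> = D\<^sup>2 * (real N * (1 + lam)) + (lam * real N + B - 2 * (B - lam * real N) * D)"
      by (simp add: power2_eq_square algebra_simps)
    also have "\<dots> = D\<^sup>2 * (real N * (1 + lam)) + (lam * real N + B - 2 * D\<^sup>2)"
      by (simp add: D_def power2_eq_square)
    also have "\<dots> \<le> (D\<^sup>2 + 1) * (real N * (1 + lam))"
    proof -
      have "B - 2 * D\<^sup>2 \<le> real N"
        using B zero_le_power2[of D] by linarith
      then show ?thesis
        by (simp add: distrib_right distrib_left mult.commute)
    qed
    finally show "(lam * (\<Sum>v<N. g True v) + (\<Sum>v<N. g False v)) / (real N * (1 + lam)) \<le> D\<^sup>2 + 1"
      using assms by (simp add: pos_divide_le_eq)
  qed
  also have "\<dots> = ennreal (D\<^sup>2) + 1"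
    by (subst ennreal_plus) auto
  finally show ?thesis
    unfolding D_def B_def .
qed

text \<open>The complete split graph: the vertices below \<open>d\<close> form a clique and are
  joined to all others, while the leaves from \<open>d\<close> on form an independent set.\<close>

definition core_graph :: "nat \<Rightarrow> nat \<Rightarrow> nat \<Rightarrow> nat \<Rightarrow> bool" where
  "core_graph d N u v \<longleftrightarrow> u < N \<and> v < N \<and> u \<noteq> v \<and> (u < d \<or> v < d)"

lemma simple_graph_core_graph: "simple_graph N (core_graph d N)"
  by (auto simp: simple_graph_def core_graph_def)

text \<open>Leaves have degree \<open>d\<close> and core vertices \<open>N - 1\<close>, which is at
  least \<open>d\<close>. Since \<open>d < N\<close>, the vertex \<open>d\<close> is a leaf and
  attains the minimum.\<close>

lemma min_degree_core_graph:
  assumes "d < N"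
  shows "min_degree N (core_graph d N) = d"
proof -
  have leaf: "degree N (core_graph d N) v = d" if "d \<le> v" "v < N" for v
  proof -
    have "{u. u < N \<and> core_graph d N v u} = {..<d}"
      using that assms by (auto simp: core_graph_def)
    then show ?thesis by (simp add: degree_def)
  qed
  have core: "degree N (core_graph d N) v = N - 1" if "v < d" for v
  proof -
    have "{u. u < N \<and> core_graph d N v u} = {..<N} - {v}"
      using that assms by (auto simp: core_graph_def)
    then show ?thesis using that assms by (simp add: degree_def)
  qed
  show ?thesis
    unfolding min_degree_def
  proof (rule Min_eqI)
    show "d \<le> m" if "m \<in> degree N (core_graph d N) ` {..<N}" for m
    proof -
      obtain v where "v < N" "m = degree N (core_graph d N) v" using \<open>m \<in> _\<close> by auto
      then show ?thesis using leaf[of v] core[of v] assms by (cases "v < d") auto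
    qed
    show "d \<in> degree N (core_graph d N) ` {..<N}"
      using leaf[of d] assms by (metis imageI lessThan_iff order_refl)
  qed simp
qed

text \<open>The only leaf in the closed neighbourhood of a leaf is the leaf itself, so a task
  arriving at a busy leaf cannot occupy an idle leaf. Every other arrival is counted as +1, which is
  an upper bound only.\<close>

lemma core_graph_step:
  fixes r2 :: real
  assumes "0 < N"
  defines "v \<equiv> pick {..<N} r2"
  shows "real (busy {d..<N} (step N (core_graph d N) lam b x (r1, r2, r3))) \<le> real (busy {d..<N} x) +
      (if r1 < lam / (1 + lam) then (if v \<in> {d..<N} \<and> 0 < x v then 0 else 1)
       else if v \<in> {d..<N} \<and> x v = 1 then -1 else 0)"
proof -
  let ?u = "pick (shortest N (core_graph d N) x v) r3" and ?L = "{d..<N}"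
  have v: "v < N" unfolding v_def using assms(1) by (rule pick_server)
  have u: "?u \<in> shortest N (core_graph d N) x v" using v by (rule pick_shortest)
  show ?thesis
  proof (cases "r1 < lam / (1 + lam)")
    case True
    then have "step N (core_graph d N) lam b x (r1, r2, r3)
        = (if enat (x ?u) < b then x(?u := Suc (x ?u)) else x)"
      by (simp add: step_def Let_def v_def)
    moreover have "v \<in> ?L \<and> 0 < x v \<longrightarrow> \<not> (?u \<in> ?L \<and> x ?u = 0)"
      using u by (auto simp: shortest_def closed_nbhd_def core_graph_def)
    ultimately show ?thesis
      using True busy_arrival[of ?L x ?u]
      by (cases "v \<in> ?L \<and> 0 < x v") (auto simp del: fun_upd_apply atLeastLessThan_iff)
  next
    case False
    then have "step N (core_graph d N) lam b x (r1, r2, r3)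
        = (if 0 < x v then x(v := x v - 1) else x)"
      by (simp add: step_def Let_def v_def)
    then show ?thesis
      using False busy_departure[of ?L x v] by (auto simp del: fun_upd_apply split: if_splits)
  qed
qed

text \<open>Let \<open>F\<close> count the busy leaves and \<open>W\<close> those with at least two
  tasks. Increases have rate at most \<open>lam * (N - F)\<close> and decreases at least
  \<open>F - W\<close>; after division by the total rate \<open>N * (1 + lam)\<close>, the
  hypothesis \<open>le\<close> says that the resulting drift is at most
  \<open>- \<delta>\<close>.\<close>

lemma core_graph_leaf_drift:
  fixes x :: state
  assumes "0 < N" "0 < lam" "0 \<le> \<delta>"
    and le: "lam * real N + real (card {v \<in> {d..<N}. 2 \<le> x v}) + \<delta> * (real N * (1 + lam))
        \<le> (1 + lam) * real (busy {d..<N} x)"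
  shows "(\<integral>\<^sup>+ s. ennreal (real (busy {d..<N} (step N (core_graph d N) lam b x (snd s)))) \<partial>driving N lam) + ennreal \<delta>
    \<le> ennreal (real (busy {d..<N} x))"
proof -
  let ?L = "{d..<N}"
  define F where "F = real (busy ?L x)"
  define W where "W = real (card {v \<in> ?L. 2 \<le> x v})"
  define g where "g a v = F + (if a then (if v \<in> ?L \<and> 0 < x v then 0 else 1)
       else if v \<in> ?L \<and> x v = 1 then -1 else 0)" for a v
  \<comment> \<open>Nonnegativity is required for integration in \<open>ennreal\<close>: the value
    -1 is used only if some leaf is busy, and then \<open>F\<close> is at least 1.\<close>
  have g0: "0 \<le> g a v" for a v
  proof -
    have "1 \<le> F" if "v \<in> ?L" "x v = 1"
    proof -
      have "card {v} \<le> busy ?L x" unfolding busy_def using that by (intro card_mono) auto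
      then show ?thesis by (simp add: F_def)
    qed
    moreover have "0 \<le> F" by (simp add: F_def)
    ultimately show ?thesis by (auto simp: g_def)
  qed
  \<comment> \<open>This ensures that \<open>ennreal (F - \<delta>)\<close> is not truncated at 0,
    so that adding \<delta> back gives \<open>F\<close>.\<close>
  have "\<delta> \<le> F"
  proof -
    have "\<delta> * (real N * (1 + lam)) \<le> (1 + lam) * F"
      using le assms(2) unfolding F_def by (smt (verit) mult_nonneg_nonneg of_nat_0_le_iff)
    then have "(1 + lam) * (\<delta> * real N) \<le> (1 + lam) * F" by (simp add: algebra_simps)
    then have "\<delta> * real N \<le> F" using assms(2) by (simp add: mult_le_cancel_left)
    moreover have "\<delta> * 1 \<le> \<delta> * real N" using assms by (intro mult_left_mono) auto
    ultimately show ?thesis by linarith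
  qed
  have "(\<integral>\<^sup>+ s. ennreal (real (busy ?L (step N (core_graph d N) lam b x (snd s)))) \<partial>driving N lam)
      \<le> (\<integral>\<^sup>+ s. ennreal (g (fst (snd s) < lam / (1 + lam)) (pick {..<N} (fst (snd (snd s))))) \<partial>driving N lam)"
  proof (rule nn_integral_mono)
    fix s :: "real \<times> real \<times> real \<times> real"
    obtain w r1 r2 r3 where s: "s = (w, r1, r2, r3)" by (cases s) auto
    show "ennreal (real (busy ?L (step N (core_graph d N) lam b x (snd s))))
        \<le> ennreal (g (fst (snd s) < lam / (1 + lam)) (pick {..<N} (fst (snd (snd s)))))"
      using core_graph_step[OF assms(1), of d lam b x r1 r2 r3]
      by (intro ennreal_leI) (simp add: s g_def F_def)
  qed
  also have "\<dots> = ennreal ((lam * (\<Sum>v<N. g True v) + (\<Sum>v<N. g False v)) / (real N * (1 + lam)))"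
    using assms g0 by (intro nn_integral_driving_event_real) auto
  also have "\<dots> \<le> ennreal (F - \<delta>)"
  proof (rule ennreal_leI)
    have c1: "{v \<in> {..<N}. v \<in> ?L \<and> 0 < x v} = {v \<in> ?L. 0 < x v}" by auto
    have c2: "{v \<in> {..<N}. v \<in> ?L \<and> x v = 1} = {v \<in> ?L. x v = 1}" by auto
    have "(\<Sum>v<N. g True v) = real N * F + (\<Sum>v<N. if v \<in> ?L \<and> 0 < x v then 0 else 1)"
      by (simp add: g_def sum.distrib)
    also have "(\<Sum>v<N. if v \<in> ?L \<and> 0 < x v then 0 else 1) = real N - F"
      unfolding sum_if_card[OF finite_lessThan] c1 by (simp add: F_def busy_def)
    finally have gT: "(\<Sum>v<N. g True v) = real N * F + (real N - F)" .
    have "(\<Sum>v<N. g False v) = real N * F + (\<Sum>v<N. if v \<in> ?L \<and> x v = 1 then -1 else 0)"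
      by (simp add: g_def sum.distrib)
    also have "(\<Sum>v<N. if v \<in> ?L \<and> x v = 1 then -1 else 0) = - real (card {v \<in> ?L. x v = 1})"
      unfolding sum_if_card[OF finite_lessThan] c2 by simp
    finally have gF: "(\<Sum>v<N. g False v) = real N * F - real (card {v \<in> ?L. x v = 1})"
      by simp
    have "{v \<in> ?L. 0 < x v} = {v \<in> ?L. x v = 1} \<union> {v \<in> ?L. 2 \<le> x v}"
      by auto
    then have "busy ?L x \<le> card {v \<in> ?L. x v = 1} + card {v \<in> ?L. 2 \<le> x v}"
      unfolding busy_def by (simp add: card_Un_le)
    then have "F \<le> real (card {v \<in> ?L. x v = 1}) + W"
      by (simp add: F_def W_def)
    then have "lam * (\<Sum>v<N. g True v) + (\<Sum>v<N. g False v)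
        \<le> lam * (real N * F + (real N - F)) + (real N * F - (F - W))"
      unfolding gT gF by simp
    also have "\<dots> = F * (real N * (1 + lam)) + (lam * real N + W - (1 + lam) * F)"
      by (simp add: algebra_simps)
    also have "\<dots> \<le> (F - \<delta>) * (real N * (1 + lam))"
      using le unfolding F_def W_def by (simp add: left_diff_distrib)
    finally show "(lam * (\<Sum>v<N. g True v) + (\<Sum>v<N. g False v)) / (real N * (1 + lam)) \<le> F - \<delta>"
      using assms by (simp add: pos_divide_le_eq)
  qed
  finally have "(\<integral>\<^sup>+ s. ennreal (real (busy ?L (step N (core_graph d N) lam b x (snd s)))) \<partial>driving N lam) + ennreal \<delta>
      \<le> ennreal (F - \<delta>) + ennreal \<delta>"
    by (rule add_right_mono)
  also have "\<dots> = ennreal F"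
    using \<open>\<delta> \<le> F\<close> assms(3) by (subst ennreal_plus[symmetric]) auto
  finally show ?thesis
    by (simp add: F_def)
qed

section \<open>The sequence metric and outer probability\<close>

lemma summable_seq_dist: "summable (\<lambda>i. (1 / 2) ^ i * min 1 \<bar>a (Suc i) - c (Suc i)\<bar> :: real)"
proof (rule summable_comparison_test')
  show "summable (\<lambda>i. (1 / 2 :: real) ^ i)" by (rule summable_geometric) simp
  show "norm ((1 / 2) ^ i * min 1 \<bar>a (Suc i) - c (Suc i)\<bar>) \<le> (1 / 2) ^ i" for i
    by (simp add: abs_mult mult_left_le)
qed

text \<open>A uniform bound keeps the supremum over time in \<open>fluid_conv\<close> a supremum of
  a bounded set of reals.\<close>

lemma seq_dist_le_2: "seq_dist a c \<le> 2"
proof -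
  have "seq_dist a c \<le> (\<Sum>i. (1 / 2) ^ i)"
    unfolding seq_dist_def
    by (intro suminf_le summable_seq_dist summable_geometric) (auto simp: mult_left_le)
  also have "\<dots> = 2" using suminf_geometric[of "1 / 2 :: real"] by simp
  finally show ?thesis .
qed

lemma seq_dist_ge: "(1 / 2) ^ i * min 1 \<bar>a (Suc i) - c (Suc i)\<bar> \<le> seq_dist a c"
proof -
  have "(\<Sum>j\<in>{i}. (1 / 2) ^ j * min 1 \<bar>a (Suc j) - c (Suc j)\<bar>) \<le> seq_dist a c"
    unfolding seq_dist_def by (intro sum_le_suminf summable_seq_dist) auto
  then show ?thesis by simp
qed

lemma seq_dist_differ_at_1:
  assumes "\<And>i. a (Suc (Suc i)) = c (Suc (Suc i))"
  shows "seq_dist a c = min 1 \<bar>a 1 - c 1\<bar>"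
proof -
  have "seq_dist a c = (\<Sum>i\<in>{0}. (1 / 2) ^ i * min 1 \<bar>a (Suc i) - c (Suc i)\<bar>)"
    unfolding seq_dist_def
  proof (rule suminf_finite)
    show "(1 / 2) ^ i * min 1 \<bar>a (Suc i) - c (Suc i)\<bar> = 0" if "i \<notin> {0}" for i
      using that assms by (cases i) auto
  qed simp
  then show ?thesis by simp
qed

lemma outer_prob_le:
  assumes "B \<in> sets M" "A \<subseteq> B"
  shows "outer_prob M A \<le> measure M B"
  unfolding outer_prob_def using assms by (intro cInf_lower) (auto intro: bdd_belowI[of _ 0])

lemma outer_prob_ge:
  assumes "A \<subseteq> space M" "\<And>B. B \<in> sets M \<Longrightarrow> A \<subseteq> B \<Longrightarrow> c \<le> measure M B"
  shows "c \<le> outer_prob M A"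
  unfolding outer_prob_def using assms by (intro cInf_greatest) auto

section \<open>Fluid limits\<close>

definition equilibrium :: "real \<Rightarrow> nat \<Rightarrow> real" where
  "equilibrium lam i = (if i = 1 then lam else 0)"

text \<open>Which servers hold the tasks is an arbitrary choice: the clique is symmetric, and the
  estimate for the core graph holds from every initial state.\<close>

definition equilibrium_state :: "real \<Rightarrow> nat \<Rightarrow> state" where
  "equilibrium_state lam N v = (if v < nat \<lfloor>lam * real N\<rfloor> then 1 else 0)"

lemma equilibrium_state_le_1: "equilibrium_state lam N v \<le> 1"
  by (simp add: equilibrium_state_def)

lemma occ_eq_0:
  assumes "\<And>v. x v \<le> 1" "2 \<le> i"
  shows "occ N x i = 0"
proof -
  have "x v < i" for v using assms(1)[of v] assms(2) by simp
  then have "{v. v < N \<and> i \<le> x v} = {}" by (simp add: not_le)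
  then show ?thesis by (simp add: occ_def)
qed

context
  fixes lam :: real
  assumes lam: "0 < lam" "lam < 1"
begin

lemma nat_floor_mult_le: "nat \<lfloor>lam * real N\<rfloor> \<le> N"
proof -
  have "lam * real N \<le> real N" using lam by (intro mult_left_le_one_le) auto
  then show ?thesis by (simp add: nat_le_iff floor_le_iff)
qed

lemma busy_equilibrium_state: "busy {..<N} (equilibrium_state lam N) = nat \<lfloor>lam * real N\<rfloor>"
proof -
  have "{v \<in> {..<N}. 0 < equilibrium_state lam N v} = {..<nat \<lfloor>lam * real N\<rfloor>}"
    using nat_floor_mult_le[of N] by (auto simp: equilibrium_state_def)
  then show ?thesis by (simp add: busy_def)
qed

lemma equilibrium_state_dev: "\<bar>real (busy {..<N} (equilibrium_state lam N)) - lam * real N\<bar> \<le> 1"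
proof -
  have "0 \<le> lam * real N" using lam by simp
  then have "real (nat \<lfloor>lam * real N\<rfloor>) = of_int \<lfloor>lam * real N\<rfloor>" by simp
  then show ?thesis unfolding busy_equilibrium_state by linarith
qed

lemma admissible_equilibrium_state:
  assumes "1 \<le> b"
  shows "admissible_init N b (equilibrium_state lam N)"
proof -
  have "enat (equilibrium_state lam N v) \<le> b" for v
  proof -
    have "enat (equilibrium_state lam N v) \<le> 1"
      using equilibrium_state_le_1[of lam N v] by (simp add: one_enat_def)
    then show ?thesis using assms by (rule order_trans)
  qed
  then show ?thesis
    using nat_floor_mult_le[of N] by (auto simp: admissible_init_def equilibrium_state_def)
qed

lemma init_conv_equilibrium_state: "init_conv (equilibrium_state lam) (equilibrium lam)"
proof -
  have "summable (\<lambda>i. equilibrium lam (Suc i))"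
    by (rule summable_finite[of "{0}"]) (auto simp: equilibrium_def)
  moreover have "(\<lambda>N. \<Sum>i. \<bar>occ N (equilibrium_state lam N) (Suc i) - equilibrium lam (Suc i)\<bar>) \<longlonglongrightarrow> 0"
  proof (rule tendsto_sandwich[of "\<lambda>_. 0" _ _ "\<lambda>N. 1 / real N"])
    have eq: "(\<Sum>i. \<bar>occ N (equilibrium_state lam N) (Suc i) - equilibrium lam (Suc i)\<bar>)
        = \<bar>occ N (equilibrium_state lam N) 1 - lam\<bar>" for N
    proof -
      have "(\<Sum>i. \<bar>occ N (equilibrium_state lam N) (Suc i) - equilibrium lam (Suc i)\<bar>)
          = (\<Sum>i\<in>{0}. \<bar>occ N (equilibrium_state lam N) (Suc i) - equilibrium lam (Suc i)\<bar>)"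
        by (rule suminf_finite) (auto simp: equilibrium_def intro!: occ_eq_0 equilibrium_state_le_1)
      then show ?thesis by (simp add: equilibrium_def)
    qed
    show "\<forall>\<^sub>F N in sequentially. 0 \<le> (\<Sum>i. \<bar>occ N (equilibrium_state lam N) (Suc i) - equilibrium lam (Suc i)\<bar>)"
      by (simp add: eq)
    show "\<forall>\<^sub>F N in sequentially. (\<Sum>i. \<bar>occ N (equilibrium_state lam N) (Suc i) - equilibrium lam (Suc i)\<bar>) \<le> 1 / real N"
      using eventually_gt_at_top[of 0]
    proof eventually_elim
      case (elim N)
      then have "\<bar>occ N (equilibrium_state lam N) 1 - lam\<bar>
          = \<bar>real (busy {..<N} (equilibrium_state lam N)) - lam * real N\<bar> / real N"
        unfolding occ_1 by (simp add: field_simps abs_divide[symmetric])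
      also have "\<dots> \<le> 1 / real N"
        using equilibrium_state_dev[of N] by (intro divide_right_mono) auto
      finally show ?case unfolding eq .
    qed
    show "(\<lambda>N. 1 / real N) \<longlonglongrightarrow> 0" by real_asymp
  qed simp
  ultimately show ?thesis
    using lam by (simp add: init_conv_def equilibrium_def)
qed

text \<open>Optional stopping for the squared deviation, which starts at no more than 1 and reaches
  \<open>(\<epsilon> * N)\<^sup>2\<close> at the exit. The condition
  \<open>\<epsilon> < 1 - lam\<close> leaves an idle server in every state of \<open>A\<close>, as
  the drift bound demands.\<close>

lemma clique_exit_bound:
  assumes "0 < N" "1 \<le> b" "0 < \<epsilon>" "\<epsilon> < 1 - lam"
  defines "A \<equiv> {x. (\<forall>v. x v \<le> 1) \<and> \<bar>real (busy {..<N} x) - lam * real N\<bar> \<le> \<epsilon> * real N}"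
  shows "measure (path_space N lam) {\<omega>. \<exists>k<n. chain N (clique N) lam b (equilibrium_state lam N) \<omega> k \<notin> A}
    \<le> (1 + real n) / (\<epsilon> * real N)\<^sup>2"
proof -
  interpret P: prob_space "path_space N lam" using assms(1) lam(1) by (rule prob_space_path_space)
  let ?V = "\<lambda>x. (real (busy {..<N} x) - lam * real N)\<^sup>2"
  let ?B = "{\<omega>. \<exists>k<n. chain N (clique N) lam b (equilibrium_state lam N) \<omega> k \<notin> A}"
  have lt: "busy {..<N} x < N" if "x \<in> A" for x
  proof -
    have "real (busy {..<N} x) \<le> (lam + \<epsilon>) * real N"
      using that by (auto simp: A_def abs_le_iff distrib_right)
    also have "\<dots> < 1 * real N"
      using assms by (intro mult_strict_right_mono) auto
    finally show ?thesis by simp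
  qed
  have "ennreal ((\<epsilon> * real N)\<^sup>2) * emeasure (path_space N lam) ?B
      \<le> ennreal (?V (equilibrium_state lam N)) + of_nat n"
  \<comment> \<open>The invariant keeps queues at most 1 up to and including the exit state. Hence
    an exit from \<open>A\<close> can only come from the deviation.\<close>
  proof (rule bounded_drift_exit[where I = "{x. \<forall>v. x v \<le> 1}"])
    show "(\<integral>\<^sup>+ s. ennreal (?V (step N (clique N) lam b x (snd s))) \<partial>driving N lam) \<le> ennreal (?V x) + 1"
      if "x \<in> {x. \<forall>v. x v \<le> 1}" "x \<in> A" for x
      using that lt[of x] assms lam by (intro clique_variance_drift) auto
    show "step N (clique N) lam b x r \<in> {x. \<forall>v. x v \<le> 1}"
      if "x \<in> {x. \<forall>v. x v \<le> 1}" "x \<in> A" for x r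
    proof -
      obtain r1 r2 r3 where "r = (r1, r2, r3)" by (cases r) auto
      then show ?thesis
        using that lt[of x] clique_step(1)[OF assms(1,2)] by auto
    qed
    show "ennreal ((\<epsilon> * real N)\<^sup>2) \<le> ennreal (?V x)" if "x \<in> {x. \<forall>v. x v \<le> 1}" "x \<notin> A" for x
    proof (rule ennreal_leI)
      have "\<epsilon> * real N \<le> \<bar>real (busy {..<N} x) - lam * real N\<bar>"
        using that by (auto simp: A_def)
      then have "(\<epsilon> * real N)\<^sup>2 \<le> \<bar>real (busy {..<N} x) - lam * real N\<bar>\<^sup>2"
        using assms by (intro power_mono) auto
      then show "(\<epsilon> * real N)\<^sup>2 \<le> ?V x" by simp
    qed
  qed (use assms lam equilibrium_state_le_1 in auto)
  then have "ennreal ((\<epsilon> * real N)\<^sup>2 * P.prob ?B) \<le> ennreal (?V (equilibrium_state lam N) + real n)"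
    by (simp add: P.emeasure_eq_measure ennreal_mult ennreal_of_nat_eq_real_of_nat)
  then have "(\<epsilon> * real N)\<^sup>2 * P.prob ?B \<le> ?V (equilibrium_state lam N) + real n"
    by (subst (asm) ennreal_le_iff) auto
  also have "?V (equilibrium_state lam N) \<le> 1"
    using equilibrium_state_dev[of N] by (simp add: abs_square_le_1)
  finally show ?thesis
    using assms by (simp add: pos_le_divide_eq mult.commute)
qed

text \<open>A large deviation before \<open>T\<close> forces an early exit of the chain, more than
  \<open>n\<close> jumps by time \<open>T\<close>, or a nonpositive holding time. With
  \<open>n\<close> proportional to \<open>N\<close> these have probability of order
  \<open>1 / N\<close>, at most \<open>(1 / 2) ^ N\<close>, and 0.\<close>

lemma fluid_conv_clique:
  assumes "1 \<le> b"
  shows "fluid_conv clique lam b (equilibrium_state lam) (\<lambda>t. equilibrium lam)"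
  unfolding fluid_conv_def
proof (intro allI impI)
  fix T \<epsilon>0 :: real
  assume T: "0 \<le> T" and \<epsilon>0: "0 < \<epsilon>0"
  \<comment> \<open>A smaller tolerance is enough, and the second bound keeps an idle server
    available.\<close>
  define \<epsilon> where "\<epsilon> = min \<epsilon>0 ((1 - lam) / 2)"
  have \<epsilon>: "0 < \<epsilon>" "\<epsilon> < 1 - lam" "\<epsilon> \<le> \<epsilon>0"
    using \<epsilon>0 lam by (auto simp: \<epsilon>_def min_def field_simps)
  \<comment> \<open>Chosen so that \<open>exp (2 * T) / 2 ^ m\<close> is below 1/2; its
    \<open>N\<close>-th power bounds the probability of more than \<open>N * m\<close> jumps by time
    \<open>T\<close>.\<close>
  obtain m :: nat where m: "2 * exp (2 * T) < 2 ^ m"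
    using real_arch_pow[of 2 "2 * exp (2 * T)"] by auto
  define bad where "bad N = {\<omega> \<in> space (path_space N lam).
      (SUP t\<in>{0..T}. seq_dist (occ N (proc N (clique N) lam b (equilibrium_state lam N) \<omega> t)) (equilibrium lam)) > \<epsilon>0}" for N
  have bound: "outer_prob (path_space N lam) (bad N)
      \<le> (2 + real N * real m) / (\<epsilon> * real N)\<^sup>2 + (1 / 2) ^ N" if "0 < N" for N
  proof -
    interpret P: prob_space "path_space N lam" using that lam(1) by (rule prob_space_path_space)
    define A where "A = {x. (\<forall>v. x v \<le> 1) \<and> \<bar>real (busy {..<N} x) - lam * real N\<bar> \<le> \<epsilon> * real N}"
    define n where "n = N * m"
    let ?B1 = "{\<omega>. \<exists>k<Suc n. chain N (clique N) lam b (equilibrium_state lam N) \<omega> k \<notin> A}"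
    let ?B2 = "{\<omega>. jump_time \<omega> (Suc n) \<le> T}"
    let ?B3 = "{\<omega> :: (real \<times> real \<times> real \<times> real) stream. \<not> (\<forall>i. 0 < fst (\<omega> !! i))}"
    have meas [measurable]: "?B1 \<in> P.events" "?B2 \<in> P.events" "?B3 \<in> P.events"
      by (rule pred_sets_path_space; measurable)+
    have dist_A: "seq_dist (occ N x) (equilibrium lam) \<le> \<epsilon>" if "x \<in> A" for x
    proof -
      have le1: "x v \<le> 1" for v using that by (simp add: A_def)
      have "seq_dist (occ N x) (equilibrium lam) = min 1 \<bar>occ N x 1 - equilibrium lam 1\<bar>"
        by (rule seq_dist_differ_at_1) (simp add: occ_eq_0[OF le1] equilibrium_def)
      also have "\<dots> \<le> \<bar>real (busy {..<N} x) / real N - lam\<bar>"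
        unfolding occ_1 by (simp add: equilibrium_def)
      also have "\<dots> = \<bar>real (busy {..<N} x) - lam * real N\<bar> / real N"
        using \<open>0 < N\<close> by (simp add: field_simps abs_divide[symmetric])
      also have "\<dots> \<le> \<epsilon>"
        using that \<open>0 < N\<close> by (simp add: A_def divide_le_eq)
      finally show ?thesis .
    qed
    have "bad N \<subseteq> ?B1 \<union> ?B2 \<union> ?B3"
    proof (rule ccontr)
      assume "\<not> bad N \<subseteq> ?B1 \<union> ?B2 \<union> ?B3"
      then obtain \<omega> where \<omega>: "\<omega> \<in> bad N" and good: "\<And>k. k < Suc n \<Longrightarrow> chain N (clique N) lam b (equilibrium_state lam N) \<omega> k \<in> A"
        and time: "T < jump_time \<omega> (Suc n)" and pos: "\<forall>i. 0 < fst (\<omega> !! i)"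
        by force
      have "(SUP t\<in>{0..T}. seq_dist (occ N (proc N (clique N) lam b (equilibrium_state lam N) \<omega> t)) (equilibrium lam)) \<le> \<epsilon>"
      proof (rule cSUP_least)
        fix t assume "t \<in> {0..T}"
        then have "njumps \<omega> t < Suc n"
          using time by (intro njumps_less pos) auto
        then show "seq_dist (occ N (proc N (clique N) lam b (equilibrium_state lam N) \<omega> t)) (equilibrium lam) \<le> \<epsilon>"
          unfolding proc_def by (intro dist_A good)
      qed (use T in auto)
      then show False using \<omega> \<epsilon>(3) by (simp add: bad_def)
    qed
    \<comment> \<open>A measurable cover suffices; measurability of the supremum over uncountably
      many times is never asked for.\<close>
    then have "outer_prob (path_space N lam) (bad N) \<le> P.prob (?B1 \<union> ?B2 \<union> ?B3)"
      by (intro outer_prob_le) measurable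
    also have "\<dots> \<le> P.prob ?B1 + P.prob ?B2 + P.prob ?B3"
      by (intro order_trans[OF measure_Un_le] add_right_mono measure_Un_le) measurable
    also have "P.prob ?B3 = 0"
      using AE_holding_times_pos[OF that lam(1)] by (simp only: P.prob_eq_0[OF meas(3)] mem_Collect_eq not_not)
    also have "P.prob ?B1 \<le> (1 + real (Suc n)) / (\<epsilon> * real N)\<^sup>2"
      unfolding A_def by (rule clique_exit_bound[OF that assms \<epsilon>(1,2)])
    also have "P.prob ?B2 \<le> (1 / 2) ^ N"
    proof -
      have "P.prob ?B2 \<le> exp (real N * (1 + lam) * T) * (1 / 2) ^ Suc n"
        using emeasure_jump_time_le[OF that lam(1), of "Suc n" T]
        by (simp add: P.emeasure_eq_measure)
      also have "\<dots> \<le> exp (real N * (2 * T)) * (1 / 2) ^ n"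
      proof (rule mult_mono)
        have "(1 + lam) * T \<le> 2 * T" using lam T by (intro mult_right_mono) auto
        then have "real N * ((1 + lam) * T) \<le> real N * (2 * T)" by (intro mult_left_mono) auto
        then show "exp (real N * (1 + lam) * T) \<le> exp (real N * (2 * T))" by (simp add: mult.assoc)
      qed auto
      also have "\<dots> = (exp (2 * T) / 2 ^ m) ^ N"
        by (simp add: n_def exp_of_nat_mult power_divide power_mult[symmetric] mult.commute)
      also have "\<dots> \<le> (1 / 2) ^ N"
        using m by (intro power_mono) (auto simp: field_simps)
      finally show ?thesis .
    qed
    finally show ?thesis by (simp add: n_def)
  qed
  have lim: "(\<lambda>N. (2 + real N * real m) / (\<epsilon> * real N)\<^sup>2 + (1 / 2) ^ N) \<longlonglongrightarrow> 0"
    using \<epsilon>(1) by real_asymp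
  show "(\<lambda>N. outer_prob (path_space N lam) (bad N)) \<longlonglongrightarrow> 0"
  proof (rule tendsto_sandwich[OF _ _ tendsto_const lim])
    show "\<forall>\<^sub>F N in sequentially. 0 \<le> outer_prob (path_space N lam) (bad N)"
      by (intro always_eventually allI outer_prob_ge) (auto simp: bad_def)
    show "\<forall>\<^sub>F N in sequentially. outer_prob (path_space N lam) (bad N)
        \<le> (2 + real N * real m) / (\<epsilon> * real N)\<^sup>2 + (1 / 2) ^ N"
      using eventually_gt_at_top[of 0] by eventually_elim (rule bound)
  qed
qed

end

text \<open>Take any measurable \<open>B\<close> containing the bad event. Outside \<open>B\<close>
  and a null set, either the chain stays near equilibrium for \<open>n = m * N\<close> steps, or
  these jumps last longer than \<open>T\<close>. The leaf drift bounds the first by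
  \<open>1 / (m * \<delta>)\<close>, hence by 1/4; Markov's inequality bounds the second by 1/4,
  since \<open>T\<close> is four times the mean duration of \<open>n\<close> jumps.\<close>

lemma core_graph_outer_prob_ge:
  fixes c lam :: real and m d N :: nat
  defines "\<epsilon> \<equiv> (1 - 2 * c) / 24" and "\<delta> \<equiv> (1 - 2 * c) / 8"
  assumes "0 < N" "0 < c" "c < 1 / 2" and lam: "lam = (3 + 2 * c) / 4"
    and d: "real d \<le> (c + \<epsilon>) * real N" and m: "4 \<le> real m * \<delta>"
  defines "T \<equiv> 4 * real m / (1 + lam)"
  shows "1 / 2 \<le> outer_prob (path_space N lam) {\<omega> \<in> space (path_space N lam).
      (SUP t\<in>{0..T}. seq_dist (occ N (proc N (core_graph d N) lam b x0 \<omega> t)) (equilibrium lam)) > \<epsilon>}"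
proof (rule outer_prob_ge)
  have lam01: "0 < lam" "lam < 1" using assms by (auto simp: lam)
  have \<epsilon>: "0 < \<epsilon>" "\<epsilon> < 1" and \<delta>: "0 < \<delta>" using assms by (auto simp: \<epsilon>_def \<delta>_def)
  have "0 < m" using m \<delta> by (cases "m = 0") auto
  then have T: "0 < T" using lam01 by (simp add: T_def)
  interpret P: prob_space "path_space N lam" using \<open>0 < N\<close> lam01(1) by (rule prob_space_path_space)
  let ?bad = "{\<omega> \<in> space (path_space N lam).
      (SUP t\<in>{0..T}. seq_dist (occ N (proc N (core_graph d N) lam b x0 \<omega> t)) (equilibrium lam)) > \<epsilon>}"
  show "?bad \<subseteq> space (path_space N lam)" by auto
  fix B assume [measurable]: "B \<in> P.events" and "?bad \<subseteq> B"
  define A where "A = {x. seq_dist (occ N x) (equilibrium lam) \<le> \<epsilon>}"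
  define n where "n = m * N"
  let ?C = "{\<omega>. \<forall>k<n. chain N (core_graph d N) lam b x0 \<omega> k \<in> A}"
  let ?J = "{\<omega>. T < jump_time \<omega> n}"
  let ?Z = "{\<omega> :: (real \<times> real \<times> real \<times> real) stream. \<not> (\<forall>i. 0 < fst (\<omega> !! i))}"
  have meas [measurable]: "?C \<in> P.events" "?J \<in> P.events" "?Z \<in> P.events"
    by (rule pred_sets_path_space; measurable)+
  have cover: "UNIV \<subseteq> B \<union> ?C \<union> ?J \<union> ?Z"
  proof (rule subsetI, rule ccontr)
    fix \<omega> assume "\<omega> \<notin> B \<union> ?C \<union> ?J \<union> ?Z"
    then obtain k where k: "k < n" "chain N (core_graph d N) lam b x0 \<omega> k \<notin> A" and "\<omega> \<notin> B"
      and time: "jump_time \<omega> n \<le> T" and pos: "\<forall>i. 0 < fst (\<omega> !! i)"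
      by force
    let ?t = "jump_time \<omega> k" and ?D = "\<lambda>t. seq_dist (occ N (proc N (core_graph d N) lam b x0 \<omega> t)) (equilibrium lam)"
    have "?t \<le> T"
      using strict_mono_less[OF strict_mono_jump_time[OF pos], of k n] k(1) time by simp
    moreover have "0 \<le> ?t"
      unfolding jump_time_def using pos by (intro sum_nonneg) (simp add: less_imp_le)
    ultimately have "?D ?t \<le> (SUP t\<in>{0..T}. ?D t)"
      by (intro cSUP_upper bdd_aboveI2[of _ _ 2] seq_dist_le_2) auto
    moreover have "\<epsilon> < ?D ?t"
      using k(2) by (simp add: proc_def njumps_jump_time[OF pos] A_def)
    ultimately have "\<omega> \<in> ?bad" by simp
    then show False using \<open>?bad \<subseteq> B\<close> \<open>\<omega> \<notin> B\<close> by blast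
  qed
  have "1 = P.prob UNIV"
    using P.prob_space by simp
  also have "\<dots> \<le> P.prob (B \<union> ?C \<union> ?J \<union> ?Z)"
    using cover by (rule P.finite_measure_mono) measurable
  also have "\<dots> \<le> P.prob B + P.prob ?C + P.prob ?J + P.prob ?Z"
    by (intro order_trans[OF measure_Un_le] add_right_mono measure_Un_le) measurable
  also have "P.prob ?Z = 0"
    using AE_holding_times_pos[OF \<open>0 < N\<close> lam01(1)] by (simp only: P.prob_eq_0[OF meas(3)] mem_Collect_eq not_not)
  also have "P.prob ?J \<le> 1 / 4"
  proof -
    have "P.prob ?J \<le> real n / (real N * (1 + lam) * T)"
      using emeasure_jump_time_gt[OF \<open>0 < N\<close> lam01(1) T, of n] T lam01
      by (simp add: P.emeasure_eq_measure)
    also have "real N * (1 + lam) * T = 4 * real n"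
      using lam01 by (simp add: T_def n_def)
    also have "real n / (4 * real n) = 1 / 4"
      using \<open>0 < N\<close> \<open>0 < m\<close> by (simp add: n_def)
    finally show ?thesis .
  qed
  also have "P.prob ?C \<le> 1 / 4"
  proof -
    have drift: "(\<integral>\<^sup>+ s. ennreal (real (busy {d..<N} (step N (core_graph d N) lam b x (snd s)))) \<partial>driving N lam)
        + ennreal \<delta> \<le> ennreal (real (busy {d..<N} x))" if "x \<in> A" for x
    proof (rule core_graph_leaf_drift)
      have "min 1 \<bar>occ N x 1 - lam\<bar> \<le> \<epsilon>"
        using seq_dist_ge[of 0 "occ N x" "equilibrium lam"] that by (simp add: A_def equilibrium_def)
      then have "lam - \<epsilon> \<le> real (busy {..<N} x) / real N"
        using \<epsilon> unfolding occ_1 by (auto simp: min_def abs_le_iff split: if_splits)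
      then have Q1: "(lam - \<epsilon>) * real N \<le> real (busy {..<N} x)"
        using \<open>0 < N\<close> by (simp add: pos_le_divide_eq)
      \<comment> \<open>The second coordinate has weight 1/2 in the metric, whence the factor 2
        below. Since \<open>\<epsilon> < 1 / 2\<close>, the truncation at 1 is inactive.\<close>
      have "1 / 2 * min 1 \<bar>occ N x 2\<bar> \<le> \<epsilon>"
        using seq_dist_ge[of 1 "occ N x" "equilibrium lam"] that
        by (simp add: A_def equilibrium_def numeral_2_eq_2)
      moreover have "\<epsilon> < 1 / 2" using assms by (simp add: \<epsilon>_def)
      ultimately have "occ N x 2 \<le> 2 * \<epsilon>"
        by (auto simp: min_def abs_le_iff split: if_splits)
      then have Q2: "real (card {v. v < N \<and> 2 \<le> x v}) \<le> 2 * \<epsilon> * real N"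
        using \<open>0 < N\<close> by (simp add: occ_def pos_divide_le_eq)
      have "card {v \<in> {d..<N}. 2 \<le> x v} \<le> card {v. v < N \<and> 2 \<le> x v}"
        by (rule card_mono) auto
      with Q2 have W: "real (card {v \<in> {d..<N}. 2 \<le> x v}) \<le> 2 * \<epsilon> * real N"
        by linarith
      \<comment> \<open>The core holds at most \<open>d\<close> of the busy servers; all remaining
        ones are leaves.\<close>
      have "{v \<in> {..<N}. 0 < x v} \<subseteq> {..<d} \<union> {v \<in> {d..<N}. 0 < x v}" by auto
      then have "busy {..<N} x \<le> card ({..<d} \<union> {v \<in> {d..<N}. 0 < x v})"
        unfolding busy_def by (intro card_mono) auto
      also have "\<dots> \<le> d + busy {d..<N} x"
        unfolding busy_def using card_Un_le[of "{..<d}" "{v \<in> {d..<N}. 0 < x v}"] by simp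
      finally have "real (busy {..<N} x) \<le> real d + real (busy {d..<N} x)" by linarith
      with Q1 d have F: "(lam - c - 2 * \<epsilon>) * real N \<le> real (busy {d..<N} x)"
        by (simp add: algebra_simps)
      have "lam + 2 * \<epsilon> + \<delta> * (1 + lam) \<le> (1 + lam) * (lam - c - 2 * \<epsilon>)"
      proof -
        \<comment> \<open>In terms of the gap \<theta> all constants are explicit, and the drift
          inequality holds with the margin \<open>\<theta> * (12 - \<theta>) / 96\<close>.\<close>
        define \<theta> where "\<theta> = 1 - 2 * c"
        have eqs: "c = (1 - \<theta>) / 2" "lam = 1 - \<theta> / 4" "\<epsilon> = \<theta> / 24" "\<delta> = \<theta> / 8"
          by (simp_all add: \<theta>_def lam \<epsilon>_def \<delta>_def field_simps)
        have "(1 + lam) * (lam - c - 2 * \<epsilon>) - (lam + 2 * \<epsilon> + \<delta> * (1 + lam)) = \<theta> * (12 - \<theta>) / 96"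
          unfolding eqs by (simp add: field_simps)
        moreover have "0 \<le> \<theta> * (12 - \<theta>) / 96" using assms by (simp add: \<theta>_def)
        ultimately show ?thesis by linarith
      qed
      then have "(lam + 2 * \<epsilon> + \<delta> * (1 + lam)) * real N \<le> (1 + lam) * (lam - c - 2 * \<epsilon>) * real N"
        by (rule mult_right_mono) simp
      also have "\<dots> \<le> (1 + lam) * real (busy {d..<N} x)"
        using F lam01 by (simp add: mult.assoc)
      finally have "lam * real N + 2 * \<epsilon> * real N + \<delta> * (real N * (1 + lam)) \<le> (1 + lam) * real (busy {d..<N} x)"
        by (simp add: algebra_simps)
      then show "lam * real N + real (card {v \<in> {d..<N}. 2 \<le> x v}) + \<delta> * (real N * (1 + lam))
          \<le> (1 + lam) * real (busy {d..<N} x)"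
        using W by linarith
    qed (use \<open>0 < N\<close> lam01 \<delta> in auto)
    have "of_nat n * (ennreal \<delta> * emeasure (path_space N lam) ?C) \<le> ennreal (real (busy {d..<N} x0))"
      using \<open>0 < N\<close> lam01(1) drift by (rule negative_drift_exit)
    also have "\<dots> \<le> ennreal (real N)"
      using busy_le_card[of "{d..<N}" x0] by (intro ennreal_leI) simp
    finally have "ennreal (real n * (\<delta> * P.prob ?C)) \<le> ennreal (real N)"
      using \<delta> by (simp add: P.emeasure_eq_measure ennreal_mult ennreal_of_nat_eq_real_of_nat)
    then have "real n * (\<delta> * P.prob ?C) \<le> real N"
      by (subst (asm) ennreal_le_iff) auto
    then have "real N * (real m * \<delta> * P.prob ?C) \<le> real N * 1"
      by (simp add: n_def ac_simps)
    then have "real m * \<delta> * P.prob ?C \<le> 1"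
      using \<open>0 < N\<close> by (simp add: mult_le_cancel_left_pos)
    moreover have "4 * P.prob ?C \<le> real m * \<delta> * P.prob ?C"
      using m by (intro mult_right_mono) auto
    ultimately show ?thesis by linarith
  qed
  finally show "1 / 2 \<le> P.prob B" by simp
qed

text \<open>The guard \<open>d N < N\<close> covers all large \<open>N\<close>, because the ratio
  tends to \<open>c < 1 / 2\<close>; for other \<open>N\<close> no simple graph on \<open>N\<close>
  vertices has minimum degree \<open>d N\<close>.\<close>

theorem theorem4p2:
  fixes d :: "nat \<Rightarrow> nat" and c :: real and b :: enat
  assumes "1 \<le> b"
    and "\<forall>N\<ge>1. 0 < d N"
    and "(\<lambda>N. real (d N) / real N) \<longlonglongrightarrow> c"
    and "0 < c" and "c < 1/2"
  shows "\<exists>lam G. 0 < lam \<and> lam < 1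
           \<and> (\<forall>N\<ge>1. simple_graph N (G N) \<and> (d N < N \<longrightarrow> min_degree N (G N) = d N))
           \<and> \<not> N_optimal_at G lam b"
proof -
  \<comment> \<open>Equivalently \<open>lam = 1 - (1 - 2 * c) / 4\<close>: close enough to 1 for the
    leaf drift to be negative, with room for the errors \<epsilon> and \<delta>.\<close>
  define lam where "lam = (3 + 2 * c) / 4"
  define G where "G N = core_graph (d N) N" for N
  define \<epsilon> where "\<epsilon> = (1 - 2 * c) / 24"
  define \<delta> where "\<delta> = (1 - 2 * c) / 8"
  have lam: "0 < lam" "lam < 1" using assms by (auto simp: lam_def)
  have pos: "0 < \<epsilon>" "0 < \<delta>" using assms by (auto simp: \<epsilon>_def \<delta>_def)
  have "\<not> fluid_conv G lam b (equilibrium_state lam) (\<lambda>t. equilibrium lam)"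
  proof
    assume conv: "fluid_conv G lam b (equilibrium_state lam) (\<lambda>t. equilibrium lam)"
    obtain m :: nat where "4 / \<delta> \<le> real m" using real_arch_simple by blast
    then have m: "4 \<le> real m * \<delta>" using pos by (simp add: pos_divide_le_eq)
    define T where "T = 4 * real m / (1 + lam)"
    have "0 \<le> T" using lam by (simp add: T_def)
    let ?p = "\<lambda>N. outer_prob (path_space N lam) {\<omega> \<in> space (path_space N lam).
      (SUP t\<in>{0..T}. seq_dist (occ N (proc N (G N) lam b (equilibrium_state lam N) \<omega> t)) (equilibrium lam)) > \<epsilon>}"
    have "?p \<longlonglongrightarrow> 0"
      using conv \<open>0 \<le> T\<close> pos(1) unfolding fluid_conv_def by blast
    then have "\<forall>\<^sub>F N in sequentially. ?p N < 1 / 2"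
      by (rule order_tendstoD) simp
    moreover have "\<forall>\<^sub>F N in sequentially. real (d N) / real N < c + \<epsilon>"
      using assms(3) pos(1) by (intro order_tendstoD) auto
    ultimately have "\<forall>\<^sub>F N in sequentially. False"
      using eventually_gt_at_top[of 0]
    proof eventually_elim
      case (elim N)
      have "real (d N) \<le> (c + \<epsilon>) * real N"
        using elim by (simp add: pos_divide_less_eq)
      then have "1 / 2 \<le> ?p N"
        unfolding G_def T_def \<epsilon>_def
        using core_graph_outer_prob_ge[OF elim(3) assms(4,5) lam_def] m by (simp add: \<epsilon>_def \<delta>_def)
      then show False using elim(1) by simp
    qed
    then show False by simp
  qed
  then have "\<not> N_optimal_at G lam b"
    \<comment> \<open>Both systems start from the same state, and the clique keeps the constant
      equilibrium as its limit, so the premises of optimality hold while its conclusion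
      fails.\<close>
    unfolding N_optimal_at_def
    using admissible_equilibrium_state[OF lam assms(1)] init_conv_equilibrium_state[OF lam]
      fluid_conv_clique[OF lam assms(1)] by blast
  moreover have "simple_graph N (G N) \<and> (d N < N \<longrightarrow> min_degree N (G N) = d N)" for N
    by (simp add: G_def simple_graph_core_graph min_degree_core_graph)
  ultimately show ?thesis using lam by blast
qed

end
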